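(* Let $d\ge2$ and let $\mathcal M\subset\mathbb S^{d-1}$ satisfy: (i) $\mathcal M$ is connected, relatively open in $\mathbb S^{d-1}$, and $\overline{\mathcal M}\ne\mathbb S^{d-1}$; (ii) $\inf_{p\in\partial_{\mathbb S}\mathcal M,\,r\in(0,1]}r^{-(d-1)}A_{\mathbb S}(\{\sigma\in\mathbb S^{d-1}\setminus\mathcal M:|\sigma-p|<r\})>0$; (iii) there are $A,N>0$ with $w_0(\sigma)\ge N^{-1}\mathrm{dist}(\sigma,\partial_{\mathbb S}\mathcal M)^A$ for all $\sigma\in\mathcal M$. Let $\Omega=\{x\in\mathbb R^d\setminus\{0\}:x/|x|\in\mathcal M\}$. Suppose $u\in C^\infty(Q_1^\Omega)$ satisfies $u_t=\Delta u$ in $Q_1^\Omega$ and $\lim_{(t,x)\to(t_0,x_0)}u(t,x)=0$ whenever $0<t_0\le1$ and $x_0\in\partial\Omega\cap B_1$. Then for any $\epsilon\in(0,1)$ and $R\in(0,1)$, $$|u(t,x)|\le N\Big(\sup_{Q_1^\Omega}|u|\Big)W_0(x)^{1-\epsilon}\quad\text{for all }(t,x)\in Q_R^\Omega,$$ where $N=N(\mathcal M,\epsilon,R)>0$.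
   Context: $A_{\mathbb S}$ is surface measure on $\mathbb S^{d-1}$, $\partial_{\mathbb S}\mathcal M=\overline{\mathcal M}\setminus\mathcal M$. For $f$ on $\mathcal M$ let $F_f(x)=f(x/|x|)$; $f\in C^\infty(\mathcal M)$ means $F_f\in C^\infty(\Omega)$, and $\nabla_{\mathbb S}f:=\nabla F_f|_{\mathcal M}$, $\Delta_{\mathbb S}f:=\Delta F_f|_{\mathcal M}$. $\mathring W^1_2(\mathcal M)$ is the closure of $C_c^\infty(\mathcal M)$ under $\|f\|_{L_2(\mathcal M)}+\|\nabla_{\mathbb S}f\|_{L_2(\mathcal M)}$. Under (i), $\Lambda_0:=\inf_{w\in C_c^\infty(\mathcal M),w\ne0}\int_{\mathcal M}|\nabla_{\mathbb S}w|^2dA_{\mathbb S}/\int_{\mathcal M}|w|^2dA_{\mathbb S}>0$ and there is a unique $w_0\in C^\infty(\mathcal M)\cap\mathring W^1_2(\mathcal M)$ with $w_0>0$, $\int_{\mathcal M}w_0^2dA_{\mathbb S}=1$, $\Delta_{\mathbb S}w_0+\Lambda_0w_0=0$ (the first Dirichlet eigenfunction); this is the $w_0$ in (iii). $\lambda_0:=-\frac{d-2}{2}+\sqrt{\Lambda_0+(\frac{d-2}{2})^2}$ and $W_0(x):=|x|^{\lambda_0}w_0(x/|x|)$. $B_R=B_R(0)$, $B_R^\Omega=\Omega\cap B_R(0)$, $Q_R^\Omega=(1-R^2,1]\times B_R^\Omega$. *)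

theory Defs
  imports "HOL-Analysis.Analysis"
begin

definition pderiv_dir :: "'a::euclidean_space \<Rightarrow> ('a \<Rightarrow> real) \<Rightarrow> 'a \<Rightarrow> real" where
  "pderiv_dir b f x = frechet_derivative f (at x) b"

fun iter_pderiv :: "'a::euclidean_space list \<Rightarrow> ('a \<Rightarrow> real) \<Rightarrow> 'a \<Rightarrow> real" where
  "iter_pderiv [] f = f"
| "iter_pderiv (b # bs) f = pderiv_dir b (iter_pderiv bs f)"

text \<open>C-infinity on an open set U: all iterated partial derivatives exist and
  are differentiable (hence continuous) on U.\<close>
definition smooth_on :: "'a::euclidean_space set \<Rightarrow> ('a \<Rightarrow> real) \<Rightarrow> bool" where
  "smooth_on U f \<longleftrightarrow> (\<forall>bs. set bs \<subseteq> Basis \<longrightarrow> iter_pderiv bs f differentiable_on U)"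

definition grad :: "('a::euclidean_space \<Rightarrow> real) \<Rightarrow> 'a \<Rightarrow> 'a" where
  "grad f x = (\<Sum>b\<in>Basis. pderiv_dir b f x *\<^sub>R b)"

definition laplacian :: "('a::euclidean_space \<Rightarrow> real) \<Rightarrow> 'a \<Rightarrow> real" where
  "laplacian f x = (\<Sum>b\<in>Basis. pderiv_dir b (pderiv_dir b f) x)"

definition cone_of :: "'a::euclidean_space set \<Rightarrow> 'a set" where
  "cone_of M = {x. x \<noteq> 0 \<and> x /\<^sub>R norm x \<in> M}"

definition radial_ext :: "('a::euclidean_space \<Rightarrow> real) \<Rightarrow> 'a \<Rightarrow> real" where
  "radial_ext f x = f (x /\<^sub>R norm x)"

definition sph_smooth :: "'a::euclidean_space set \<Rightarrow> ('a \<Rightarrow> real) \<Rightarrow> bool" where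
  "sph_smooth M f \<longleftrightarrow> smooth_on (cone_of M) (radial_ext f)"

definition sph_grad :: "('a::euclidean_space \<Rightarrow> real) \<Rightarrow> 'a \<Rightarrow> 'a" where
  "sph_grad f \<sigma> = grad (radial_ext f) \<sigma>"

definition sph_laplacian :: "('a::euclidean_space \<Rightarrow> real) \<Rightarrow> 'a \<Rightarrow> real" where
  "sph_laplacian f \<sigma> = laplacian (radial_ext f) \<sigma>"

definition sph_test_fun :: "'a::euclidean_space set \<Rightarrow> ('a \<Rightarrow> real) \<Rightarrow> bool" where
  "sph_test_fun M w \<longleftrightarrow> sph_smooth M w \<and>
     (\<exists>K. compact K \<and> K \<subseteq> M \<and> (\<forall>\<sigma>\<in>M - K. w \<sigma> = 0))"

text \<open>A_S(E) = d * Lebesgue measure of {x : 0 < |x| < 1, x/|x| \<in> E} (cone construction).\<close>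
definition sphere_measure :: "'a::euclidean_space measure" where
  "sphere_measure =
     density (distr (restrict_space lborel (ball 0 1 - {0}))
                    (restrict_space borel (sphere 0 1)) (\<lambda>x. x /\<^sub>R norm x))
             (\<lambda>_. ennreal (real DIM('a)))"

definition sph_L2norm :: "'a::euclidean_space set \<Rightarrow> ('a \<Rightarrow> real) \<Rightarrow> real" where
  "sph_L2norm M f = sqrt (set_lebesgue_integral sphere_measure M (\<lambda>\<sigma>. (f \<sigma>)\<^sup>2))"

definition sph_sq_integrable :: "'a::euclidean_space set \<Rightarrow> ('a \<Rightarrow> real) \<Rightarrow> bool" where
  "sph_sq_integrable M f \<longleftrightarrow> f \<in> borel_measurable (restrict_space sphere_measure M) \<and>
     set_integrable sphere_measure M (\<lambda>\<sigma>. (f \<sigma>)\<^sup>2)"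

text \<open>For a smooth f on M: f belongs to the closure of C_c^infinity(M) in the norm
  ||f||_L2 + ||grad_S f||_L2.\<close>
definition in_W12_0 :: "'a::euclidean_space set \<Rightarrow> ('a \<Rightarrow> real) \<Rightarrow> bool" where
  "in_W12_0 M f \<longleftrightarrow> sph_sq_integrable M f \<and> sph_sq_integrable M (\<lambda>\<sigma>. norm (sph_grad f \<sigma>)) \<and>
     (\<exists>\<phi>::nat \<Rightarrow> 'a \<Rightarrow> real. (\<forall>n. sph_test_fun M (\<phi> n)) \<and>
        (\<lambda>n. sph_L2norm M (\<lambda>\<sigma>. f \<sigma> - \<phi> n \<sigma>)
             + sph_L2norm M (\<lambda>\<sigma>. norm (sph_grad f \<sigma> - sph_grad (\<phi> n) \<sigma>))) \<longlonglongrightarrow> 0)"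

definition Lambda0 :: "'a::euclidean_space set \<Rightarrow> real" where
  "Lambda0 M = (INF w\<in>{w. sph_test_fun M w \<and> (\<exists>\<sigma>\<in>M. w \<sigma> \<noteq> 0)}.
      set_lebesgue_integral sphere_measure M (\<lambda>\<sigma>. (norm (sph_grad w \<sigma>))\<^sup>2)
      / set_lebesgue_integral sphere_measure M (\<lambda>\<sigma>. (w \<sigma>)\<^sup>2))"

definition lambda0 :: "'a::euclidean_space set \<Rightarrow> real" where
  "lambda0 M = - (real DIM('a) - 2) / 2 + sqrt (Lambda0 M + ((real DIM('a) - 2) / 2)\<^sup>2)"

definition first_dirichlet_eigenfunction :: "'a::euclidean_space set \<Rightarrow> ('a \<Rightarrow> real) \<Rightarrow> bool" where
  "first_dirichlet_eigenfunction M w \<longleftrightarrow> sph_smooth M w \<and> in_W12_0 M w \<and>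
     (\<forall>\<sigma>\<in>M. w \<sigma> > 0) \<and>
     set_lebesgue_integral sphere_measure M (\<lambda>\<sigma>. (w \<sigma>)\<^sup>2) = 1 \<and>
     (\<forall>\<sigma>\<in>M. sph_laplacian w \<sigma> + Lambda0 M * w \<sigma> = 0)"

definition W0 :: "'a::euclidean_space set \<Rightarrow> ('a \<Rightarrow> real) \<Rightarrow> 'a \<Rightarrow> real" where
  "W0 M w0 x = norm x powr lambda0 M * w0 (x /\<^sub>R norm x)"

definition parab_cyl :: "'a::euclidean_space set \<Rightarrow> real \<Rightarrow> (real \<times> 'a) set" where
  "parab_cyl \<Omega> R = {(t, x). 1 - R\<^sup>2 < t \<and> t \<le> 1 \<and> x \<in> \<Omega> \<inter> ball 0 R}"

definition time_deriv :: "(real \<times> 'a::euclidean_space \<Rightarrow> real) \<Rightarrow> real \<times> 'a \<Rightarrow> real" where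
  "time_deriv u p = pderiv_dir (1, 0) u p"

definition space_laplacian :: "(real \<times> 'a::euclidean_space \<Rightarrow> real) \<Rightarrow> real \<times> 'a \<Rightarrow> real" where
  "space_laplacian u p = laplacian (\<lambda>y. u (fst p, y)) (snd p)"

end

theory Submission
  imports Defs
begin

text \<open>Write W for the positive harmonic function \<open>W0\<close> on the cone \<open>\<Omega>\<close>. The convolution of
  \<open>|z|^(1 - d)\<close> with the indicator of the complement of \<open>\<Omega>\<close> in the unit ball is bounded and has
  Laplacian \<open>(d - 1) |z|^(-d - 1)\<close> convolved with the same indicator, which by the density
  hypothesis is at least a multiple of 1/\<open>\<rho>\<close>, with \<open>\<rho>\<close> the distance to the boundary. Subtracted
  from a constant it gives a function h between 1 and H with \<open>\<Delta>h \<le> - \<kappa> / \<rho>\<close>. For \<open>a \<ge> 0\<close>,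
  \<open>c > 0\<close> and \<open>a + c < 1\<close> the product \<open>W^a h^c\<close> is strictly superharmonic, and by the lower bound
  on \<open>w0\<close> a small power \<open>W^\<gamma>\<close> dominates a multiple of \<open>\<rho>\<close>. If solutions are bounded by \<open>W^a\<close>,
  compare them on small parabolic cylinders of radius r below (t0, x0) with
  \<open>\<eta> W^a h^c + B W^(a + \<gamma>) h^c\<close>, where \<open>\<eta> = (|x - x0|^2 + t0 - t) / r^2\<close> is at least 1 on the
  bottom and the lateral sides: the second term pays for the derivatives of \<open>\<eta>\<close>, and as \<open>\<eta>\<close>
  vanishes at (t0, x0), the bound improves there to \<open>W^(a + \<gamma>)\<close>.
  Starting from the trivial bound a = 0, finitely many steps reach \<open>1 - \<epsilon>\<close>.\<close>

section \<open>First and second derivatives along lines\<close>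

text \<open>The boundary may be irregular and \<open>W\<close> is harmonic without any slack, so
  strict superharmonicity has to come from the size of the complement alone. The power 1 - d fits
  this: |z|^(1 - d) is integrable near 0, while its Laplacian has degree -d - 1 and a positive
  coefficient, so a piece of the complement of volume about \<rho>^d at distance about \<rho>
  contributes a multiple of 1/\<rho>. The negative square of the logarithmic gradient that W^a h^c
  leaves over carries the factor 1/(a + c) - 1. It degenerates at a + c = 1, and c > 0 is what
  brings in h; hence the method stops short of the exponent 1, which is the loss of \<epsilon>. A
  gain \<gamma> is possible when W^\<gamma> dominates \<rho>. Since W \<ge> const \<rho>^A for some
  A and \<rho> is bounded, this holds whenever \<gamma> A \<le> 1, so about A steps suffice. Every
  step shrinks the cylinder, so the bounds are carried for all radii R < 1 and all solutions at
  once.\<close>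

text \<open>A Laplacian is recorded as the sum of the numbers \<open>e\<close> over the coordinate
  lines through a point. This one-dimensional notion is closed under sums, products and real powers
  and supports the second derivative test, so barriers are handled line by line.\<close>

definition derivs2 :: "(real \<Rightarrow> real) \<Rightarrow> real \<Rightarrow> real \<Rightarrow> bool" where
  "derivs2 k d e \<longleftrightarrow> (\<exists>g. (\<forall>\<^sub>F s in nhds 0. (k has_real_derivative g s) (at s)) \<and>
     g 0 = d \<and> (g has_real_derivative e) (at 0))"

lemma derivs2I:
  assumes "\<And>s. \<bar>s\<bar> < r \<Longrightarrow> (k has_real_derivative g s) (at s)" "0 < r"
    "g 0 = d" "(g has_real_derivative e) (at 0)"
  shows "derivs2 k d e"
  unfolding derivs2_def eventually_nhds_metric using assms by (auto simp: dist_real_def)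

lemma derivs2_deriv: "derivs2 k d e \<Longrightarrow> (k has_real_derivative d) (at 0)"
  unfolding derivs2_def by (metis eventually_nhds_x_imp_x)

lemma derivs2_uminus: "derivs2 k d e \<Longrightarrow> derivs2 (\<lambda>s. - k s) (- d) (- e)"
  unfolding derivs2_def
proof (elim exE conjE)
  fix g assume g: "\<forall>\<^sub>F s in nhds 0. (k has_real_derivative g s) (at s)"
    "g 0 = d" "(g has_real_derivative e) (at 0)"
  show "\<exists>g. (\<forall>\<^sub>F s in nhds 0. ((\<lambda>s. - k s) has_real_derivative g s) (at s)) \<and>
     g 0 = - d \<and> (g has_real_derivative - e) (at 0)"
    using g by (intro exI[of _ "\<lambda>s. - g s"])
      (auto intro!: derivative_eq_intros elim!: eventually_mono)
qed

lemma derivs2_add: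
  assumes "derivs2 k d e" "derivs2 l d' e'"
  shows "derivs2 (\<lambda>s. k s + l s) (d + d') (e + e')"
proof -
  obtain g g' where g: "\<forall>\<^sub>F s in nhds 0. (k has_real_derivative g s) (at s)"
      "g 0 = d" "(g has_real_derivative e) (at 0)"
    and g': "\<forall>\<^sub>F s in nhds 0. (l has_real_derivative g' s) (at s)"
      "g' 0 = d'" "(g' has_real_derivative e') (at 0)"
    using assms unfolding derivs2_def by blast
  have "\<forall>\<^sub>F s in nhds 0. ((\<lambda>s. k s + l s) has_real_derivative g s + g' s) (at s)"
    using g(1) g'(1) by eventually_elim (rule DERIV_add)
  then show ?thesis
    unfolding derivs2_def using g g'
    by (intro exI[of _ "\<lambda>s. g s + g' s"]) (auto intro!: derivative_eq_intros)
qed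

lemma derivs2_mult:
  assumes "derivs2 k d e" "derivs2 l d' e'"
  shows "derivs2 (\<lambda>s. k s * l s) (d * l 0 + k 0 * d') (e * l 0 + 2 * d * d' + k 0 * e')"
proof -
  obtain g g' where g: "\<forall>\<^sub>F s in nhds 0. (k has_real_derivative g s) (at s)"
      "g 0 = d" "(g has_real_derivative e) (at 0)"
    and g': "\<forall>\<^sub>F s in nhds 0. (l has_real_derivative g' s) (at s)"
      "g' 0 = d'" "(g' has_real_derivative e') (at 0)"
    using assms unfolding derivs2_def by blast
  have "\<forall>\<^sub>F s in nhds 0. ((\<lambda>s. k s * l s) has_real_derivative g s * l s + k s * g' s) (at s)"
    using g(1) g'(1) by eventually_elim (auto intro!: derivative_eq_intros)
  moreover have "((\<lambda>s. g s * l s + k s * g' s) has_real_derivative e * l 0 + 2 * d * d' + k 0 * e') (at 0)"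
    using g g' derivs2_deriv[OF assms(1)] derivs2_deriv[OF assms(2)]
    by (auto intro!: derivative_eq_intros simp: algebra_simps)
  ultimately show ?thesis
    unfolding derivs2_def using g g'
    by (intro exI[of _ "\<lambda>s. g s * l s + k s * g' s"]) auto
qed

lemma derivs2_const: "derivs2 (\<lambda>s. c) 0 0"
  by (rule derivs2I[where g = "\<lambda>_. 0" and r = 1]) auto

lemma derivs2_cmult: "derivs2 k d e \<Longrightarrow> derivs2 (\<lambda>s. c * k s) (c * d) (c * e)"
  using derivs2_mult[OF derivs2_const, of k d e c] by simp

lemma DERIV_powr_pos:
  assumes "(k has_real_derivative d) (at s)" "k s > 0"
  shows "((\<lambda>s. k s powr a) has_real_derivative a * k s powr (a - 1) * d) (at s)"
  using DERIV_chain2[OF has_real_derivative_powr[OF assms(2)] assms(1)] .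

lemma derivs2_powr:
  assumes "derivs2 k d e" "k 0 > 0"
  shows "derivs2 (\<lambda>s. k s powr a) (a * k 0 powr (a - 1) * d)
     (a * (a - 1) * k 0 powr (a - 2) * d\<^sup>2 + a * k 0 powr (a - 1) * e)"
proof -
  obtain g where g: "\<forall>\<^sub>F s in nhds 0. (k has_real_derivative g s) (at s)"
      "g 0 = d" "(g has_real_derivative e) (at 0)"
    using assms unfolding derivs2_def by blast
  note k = derivs2_deriv[OF assms(1)]
  have "(k \<longlongrightarrow> k 0) (nhds 0)"
    using DERIV_isCont[OF k] unfolding isCont_def by (simp add: tendsto_at_iff_tendsto_nhds)
  then have "\<forall>\<^sub>F s in nhds 0. k s > 0"
    using assms(2) order_tendstoD(1) by blast
  then have "\<forall>\<^sub>F s in nhds 0. ((\<lambda>s. k s powr a) has_real_derivative a * k s powr (a - 1) * g s) (at s)"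
    using g(1) by eventually_elim (rule DERIV_powr_pos)
  moreover have "((\<lambda>s. a * k s powr (a - 1) * g s) has_real_derivative
      a * ((a - 1) * k 0 powr (a - 1 - 1) * d) * g 0 + e * (a * k 0 powr (a - 1))) (at 0)"
    by (intro DERIV_mult DERIV_cmult DERIV_powr_pos k g assms)
  then have "((\<lambda>s. a * k s powr (a - 1) * g s) has_real_derivative
      a * (a - 1) * k 0 powr (a - 2) * d\<^sup>2 + a * k 0 powr (a - 1) * e) (at 0)"
    using g(2) by (simp add: power2_eq_square mult_ac)
  ultimately show ?thesis
    unfolding derivs2_def using g by (intro exI[of _ "\<lambda>s. a * k s powr (a - 1) * g s"]) auto
qed

lemma derivs2_rescale:
  assumes "derivs2 k d e"
  shows "derivs2 (\<lambda>s. k (c * s)) (c * d) (c\<^sup>2 * e)"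
proof -
  obtain g where g: "\<forall>\<^sub>F s in nhds 0. (k has_real_derivative g s) (at s)"
      "g 0 = d" "(g has_real_derivative e) (at 0)"
    using assms unfolding derivs2_def by blast
  have lim: "filterlim (\<lambda>s. c * s) (nhds 0) (nhds (0::real))"
    by (rule tendsto_eq_intros tendsto_ident_at filterlim_ident refl | simp)+
  have "\<forall>\<^sub>F s in nhds 0. (k has_real_derivative g (c * s)) (at (c * s))"
    using eventually_compose_filterlim[OF g(1) lim] .
  then have "\<forall>\<^sub>F s in nhds 0. ((\<lambda>s. k (c * s)) has_real_derivative c * g (c * s)) (at s)"
    by eventually_elim (subst mult.commute, rule DERIV_chain2[of k], auto intro!: derivative_eq_intros)
  moreover have "((\<lambda>s. c * g (c * s)) has_real_derivative c * (e * c)) (at 0)"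
    using g(3) by (intro DERIV_cmult DERIV_chain2[of g e "\<lambda>s. c * s"]) (auto intro!: derivative_eq_intros)
  ultimately show ?thesis
    unfolding derivs2_def using g
    by (intro exI[of _ "\<lambda>s. c * g (c * s)"]) (auto simp: power2_eq_square mult_ac)
qed

text \<open>If \<open>e\<close> were positive, the derivative would vanish at 0 and be positive just
  to the right of 0, and the mean value theorem would lift \<open>k\<close> above
  \<open>k 0\<close>.\<close>

lemma derivs2_local_max:
  assumes k: "derivs2 k d e" and max: "\<forall>\<^sub>F s in nhds 0. k s \<le> k 0"
  shows "e \<le> 0"
proof (rule ccontr)
  assume "\<not> e \<le> 0"
  obtain g where g: "\<forall>\<^sub>F s in nhds 0. (k has_real_derivative g s) (at s)"
      "g 0 = d" "(g has_real_derivative e) (at 0)"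
    using k unfolding derivs2_def by blast
  obtain r where r: "r > 0" "\<And>s. \<bar>s\<bar> < r \<Longrightarrow> (k has_real_derivative g s) (at s)"
    using g(1) unfolding eventually_nhds_metric by (auto simp: dist_real_def)
  obtain r' where r': "r' > 0" "\<And>s. \<bar>s\<bar> < r' \<Longrightarrow> k s \<le> k 0"
    using max unfolding eventually_nhds_metric by (auto simp: dist_real_def)
  have "d = 0"
    using DERIV_local_max[OF derivs2_deriv[OF k] r'(1)] r'(2) by auto
  then obtain q where q: "q > 0" "\<And>s. s > 0 \<Longrightarrow> s < q \<Longrightarrow> g s > 0"
    using DERIV_pos_inc_right[OF g(3)] \<open>\<not> e \<le> 0\<close> g(2) by auto
  define s where "s = min r (min r' q) / 2"
  have s: "0 < s" "s < r" "s < r'" "s < q"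
    using r(1) r'(1) q(1) by (auto simp: s_def min_def)
  obtain z where "0 < z" "z < s" "k s - k 0 = (s - 0) * g z"
    using MVT2[of 0 s k g] s r(2) by (metis abs_of_nonneg less_eq_real_def order_le_less_trans)
  then show False
    using q(2)[of z] s r'(2)[of s]
    by (smt (verit) mult_pos_pos)
qed

text \<open>Bridge from the iterated Frechet derivatives in \<open>smooth_on\<close> to derivatives
  along lines; only the lists \<open>[]\<close> and \<open>[b]\<close> enter.\<close>

lemma derivs2_smooth_line:
  fixes x :: "'a::euclidean_space"
  assumes f: "smooth_on U f" and U: "open U" "x \<in> U" and b: "b \<in> Basis"
  shows "derivs2 (\<lambda>s. f (x + s *\<^sub>R b)) (pderiv_dir b f x) (pderiv_dir b (pderiv_dir b f) x)"
proof -
  have line: "((\<lambda>s. g (x + s *\<^sub>R b)) has_real_derivative pderiv_dir b g (x + s *\<^sub>R b)) (at s)"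
    if g: "g differentiable_on U" and s: "x + s *\<^sub>R b \<in> U" for g :: "'a \<Rightarrow> real" and s
  proof -
    have "g differentiable at (x + s *\<^sub>R b)"
      using g s U(1) by (simp add: differentiable_on_eq_differentiable_at)
    then have G: "(g has_derivative frechet_derivative g (at (x + s *\<^sub>R b))) (at (x + s *\<^sub>R b))"
      by (simp add: frechet_derivative_works)
    have "((\<lambda>s. g (x + s *\<^sub>R b)) has_derivative
        (\<lambda>h. frechet_derivative g (at (x + s *\<^sub>R b)) (h *\<^sub>R b))) (at s)"
      by (rule has_derivative_compose[of "\<lambda>s. x + s *\<^sub>R b", OF _ G]) (auto intro!: derivative_eq_intros)
    then show ?thesis
      using linear_scale[OF has_derivative_linear[OF G]]
      by (simp add: has_field_derivative_def pderiv_dir_def mult.commute[of _ "frechet_derivative g _ b"])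
  qed
  have d0: "f differentiable_on U"
    using f[unfolded smooth_on_def, rule_format, of "[]"] by simp
  have d1: "pderiv_dir b f differentiable_on U"
    using f[unfolded smooth_on_def, rule_format, of "[b]"] b by simp
  have lim: "filterlim (\<lambda>s. x + s *\<^sub>R b) (nhds x) (nhds 0)"
    by (rule tendsto_eq_intros tendsto_ident_at filterlim_ident refl | simp)+
  have "\<forall>\<^sub>F s in nhds 0. x + s *\<^sub>R b \<in> U"
    using eventually_compose_filterlim[OF eventually_nhds_in_open[OF U] lim] .
  then have "\<forall>\<^sub>F s in nhds 0. ((\<lambda>s. f (x + s *\<^sub>R b)) has_real_derivative pderiv_dir b f (x + s *\<^sub>R b)) (at s)"
    by eventually_elim (rule line[OF d0])
  moreover have "((\<lambda>s. pderiv_dir b f (x + s *\<^sub>R b)) has_real_derivative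
      pderiv_dir b (pderiv_dir b f) x) (at 0)"
    using line[OF d1, of 0] U by simp
  ultimately show ?thesis
    unfolding derivs2_def by (intro exI[of _ "\<lambda>s. pderiv_dir b f (x + s *\<^sub>R b)"]) auto
qed

text \<open>Along a line the squared norm is a quadratic polynomial in the parameter, so this form
  makes powers of the norm easy to differentiate.\<close>

lemma norm_powr_eq: "norm x powr q = ((norm x)\<^sup>2) powr (q / 2)" for x :: "'a::real_normed_vector"
  by (cases "x = 0") (simp_all add: powr_powr flip: powr_numeral)

section \<open>Riesz potentials\<close>

lemma DERIV_norm_powr_line:
  fixes x b :: "'a::euclidean_space"
  assumes "norm b = 1" "x + s *\<^sub>R b \<noteq> 0"
  shows "((\<lambda>s. norm (x + s *\<^sub>R b) powr p) has_real_derivative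
     p * norm (x + s *\<^sub>R b) powr (p - 2) * ((x + s *\<^sub>R b) \<bullet> b)) (at s)"
proof -
  have sq: "(norm (x + s *\<^sub>R b))\<^sup>2 = (norm x)\<^sup>2 + 2 * (x \<bullet> b) * s + s\<^sup>2" for s
    using assms(1) unfolding power2_norm_eq_inner norm_eq_1
    by (simp add: inner_add_left inner_add_right inner_commute power2_eq_square algebra_simps)
  have "((\<lambda>s. (norm (x + s *\<^sub>R b))\<^sup>2) has_real_derivative 2 * ((x + s *\<^sub>R b) \<bullet> b)) (at s)"
    using assms(1) unfolding sq
    by (auto intro!: derivative_eq_intros simp: norm_eq_1 inner_add_left)
  from DERIV_powr_pos[OF this, of "p / 2"] assms(2) show ?thesis
    by (simp add: norm_powr_eq[of _ p] norm_powr_eq[of _ "p - 2"] diff_divide_distrib mult_ac)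
qed

lemma DERIV_norm_powr_inner_line:
  fixes x b :: "'a::euclidean_space"
  assumes "norm b = 1" "x + s *\<^sub>R b \<noteq> 0"
  shows "((\<lambda>s. p * norm (x + s *\<^sub>R b) powr (p - 2) * ((x + s *\<^sub>R b) \<bullet> b)) has_real_derivative
     p * (p - 2) * norm (x + s *\<^sub>R b) powr (p - 4) * ((x + s *\<^sub>R b) \<bullet> b)\<^sup>2
     + p * norm (x + s *\<^sub>R b) powr (p - 2)) (at s)"
proof -
  have "((\<lambda>s. (x + s *\<^sub>R b) \<bullet> b) has_real_derivative 1) (at s)"
    using assms(1) by (auto intro!: derivative_eq_intros simp: norm_eq_1 inner_add_left)
  from DERIV_mult[OF DERIV_cmult[OF DERIV_norm_powr_line[OF assms, of "p - 2"], of p] this]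
  show ?thesis
    by (simp add: power2_eq_square mult_ac add_ac)
qed

lemma derivs2_norm_powr_line:
  fixes x b :: "'a::euclidean_space"
  assumes b: "norm b = 1" and x: "x \<noteq> 0"
  shows "derivs2 (\<lambda>s. norm (x + s *\<^sub>R b) powr p) (p * norm x powr (p - 2) * (x \<bullet> b))
     (p * (p - 2) * norm x powr (p - 4) * (x \<bullet> b)\<^sup>2 + p * norm x powr (p - 2))"
proof (rule derivs2I)
  show "0 < norm x" using x by simp
  show "((\<lambda>s. norm (x + s *\<^sub>R b) powr p) has_real_derivative
     p * norm (x + s *\<^sub>R b) powr (p - 2) * ((x + s *\<^sub>R b) \<bullet> b)) (at s)" if "\<bar>s\<bar> < norm x" for s
  proof (rule DERIV_norm_powr_line[OF b])
    show "x + s *\<^sub>R b \<noteq> 0"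
      using that b by (metis abs_norm_cancel add_eq_0_iff mult.right_neutral norm_minus_cancel
          norm_scaleR order_less_irrefl)
  qed
  show "((\<lambda>s. p * norm (x + s *\<^sub>R b) powr (p - 2) * ((x + s *\<^sub>R b) \<bullet> b)) has_real_derivative
     p * (p - 2) * norm x powr (p - 4) * (x \<bullet> b)\<^sup>2 + p * norm x powr (p - 2)) (at 0)"
    using DERIV_norm_powr_inner_line[OF b, of x 0 p] x by simp
qed simp

lemma sum_Basis_power2: "(\<Sum>b\<in>Basis. (x \<bullet> b)\<^sup>2) = (norm x)\<^sup>2" for x :: "'a::euclidean_space"
  unfolding power2_norm_eq_inner by (subst euclidean_inner) (simp add: power2_eq_square)

lemma norm_powr_minus2: "norm x powr (p - 2) * (norm x)\<^sup>2 = norm x powr p"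
  if "x \<noteq> 0" for x :: "'a::real_normed_vector"
  using that by (simp add: powr_diff)

text \<open>Used with p = 1 - d, where the coefficient is d - 1 > 0, and with p =
  \<open>lambda0 M\<close>, where it is \<open>Lambda0 M\<close>.\<close>

lemma laplacian_norm_powr:
  fixes x :: "'a::euclidean_space"
  assumes "x \<noteq> 0"
  shows "(\<Sum>b\<in>Basis. p * (p - 2) * norm x powr (p - 4) * (x \<bullet> b)\<^sup>2 + p * norm x powr (p - 2))
     = p * (p + real DIM('a) - 2) * norm x powr (p - 2)"
proof -
  have "(\<Sum>b\<in>Basis. p * (p - 2) * norm x powr (p - 4) * (x \<bullet> b)\<^sup>2) =
      p * (p - 2) * norm x powr (p - 2)"
    using norm_powr_minus2[OF assms, of "p - 2"]
    by (simp add: sum_Basis_power2 mult.assoc flip: sum_distrib_left)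
  then show ?thesis
    unfolding sum.distrib by (simp add: algebra_simps)
qed

text \<open>By the mean value inequality the constant \<open>C\<close> dominates all difference
  quotients, and it is integrable because the measure is finite.\<close>

lemma DERIV_integral:
  fixes f f' :: "real \<Rightarrow> 'a \<Rightarrow> real"
  assumes fin: "finite_measure M"
    and int: "\<And>s. \<bar>s\<bar> < r \<Longrightarrow> integrable M (f s)"
    and der: "\<And>s y. \<bar>s\<bar> < r \<Longrightarrow> y \<in> space M \<Longrightarrow> ((\<lambda>s. f s y) has_real_derivative f' s y) (at s)"
    and bnd: "\<And>s y. \<bar>s\<bar> < r \<Longrightarrow> y \<in> space M \<Longrightarrow> \<bar>f' s y\<bar> \<le> C"
    and s: "\<bar>s\<bar> < r" and meas: "f' s \<in> borel_measurable M"
  shows "((\<lambda>s. \<integral>y. f s y \<partial>M) has_real_derivative (\<integral>y. f' s y \<partial>M)) (at s)"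
proof -
  interpret finite_measure M by (rule fin)
  \<comment> \<open>Increments restricted to this open ball have the same limit at 0, and every
    sequence \<open>X\<close> then stays where the hypotheses on \<open>f\<close> hold.\<close>
  define B where "B = ball (0::real) (r - \<bar>s\<bar>)"
  have B: "open B" "0 \<in> B" "\<And>h. h \<in> B \<Longrightarrow> \<bar>s + h\<bar> < r"
    using s by (auto simp: B_def dist_real_def)
  have "((\<lambda>h. ((\<integral>y. f (s + h) y \<partial>M) - (\<integral>y. f s y \<partial>M)) / h) \<longlongrightarrow> (\<integral>y. f' s y \<partial>M)) (at 0 within B)"
    unfolding tendsto_at_iff_sequentially
  proof (intro allI impI)
    fix X :: "nat \<Rightarrow> real"
    assume X: "\<forall>i. X i \<in> B - {0}" "X \<longlonglongrightarrow> 0"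
    have "(\<lambda>i. \<integral>y. (f (s + X i) y - f s y) / X i \<partial>M) \<longlonglongrightarrow> (\<integral>y. f' s y \<partial>M)"
    proof (rule integral_dominated_convergence[where w = "\<lambda>_. C"])
      show "(\<lambda>y. (f (s + X i) y - f s y) / X i) \<in> borel_measurable M" for i
        using borel_measurable_integrable[OF int[of "s + X i"]] borel_measurable_integrable[OF int[OF s]] B X
        by (intro borel_measurable_divide borel_measurable_diff) auto
      show "AE y in M. (\<lambda>i. (f (s + X i) y - f s y) / X i) \<longlonglongrightarrow> f' s y"
      proof (rule AE_I2)
        fix y assume "y \<in> space M"
        then have "(\<lambda>h. (f (s + h) y - f s y) / h) \<midarrow>0\<rightarrow> f' s y"
          using der[OF s] by (simp add: DERIV_def)
        then show "(\<lambda>i. (f (s + X i) y - f s y) / X i) \<longlonglongrightarrow> f' s y"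
          using X unfolding tendsto_at_iff_sequentially o_def by auto
      qed
      show "AE y in M. norm ((f (s + X i) y - f s y) / X i) \<le> C" for i
      proof (rule AE_I2)
        fix y assume y: "y \<in> space M"
        have Xi: "X i \<noteq> 0" "\<bar>s + X i\<bar> < r" using X B by auto
        have "norm (f (s + X i) y - f s y) \<le> C * norm (s + X i - s)"
        proof (rule field_differentiable_bound[where S = "ball 0 r"])
          show "((\<lambda>s. f s y) has_real_derivative f' z y) (at z within ball 0 r)"
            if "z \<in> ball 0 r" for z
            using der[of z y] that y by (auto simp: dist_real_def intro: has_field_derivative_at_within)
        qed (use bnd y Xi s in \<open>auto simp: dist_real_def\<close>)
        then show "norm ((f (s + X i) y - f s y) / X i) \<le> C"
          using Xi by (simp add: field_simps)
      qed
    qed (use meas in auto)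
    moreover have "(\<integral>y. (f (s + X i) y - f s y) / X i \<partial>M) =
        ((\<integral>y. f (s + X i) y \<partial>M) - (\<integral>y. f s y \<partial>M)) / X i" for i
      using int[of "s + X i"] int[OF s] B(3)[of "X i"] X(1)[rule_format, of i] by simp
    ultimately show "((\<lambda>h. ((\<integral>y. f (s + h) y \<partial>M) - (\<integral>y. f s y \<partial>M)) / h) \<circ> X) \<longlonglongrightarrow> (\<integral>y. f' s y \<partial>M)"
      by (simp only: o_def)
  qed
  then show ?thesis
    unfolding DERIV_def at_within_open[OF B(2,1)] .
qed

text \<open>The distance \<delta> from \<open>x\<close> to \<open>E\<close> keeps the kernel and its
  first two line derivatives bounded for |s| < \<delta> / 2, so differentiation under the integral
  applies twice.\<close>

lemma derivs2_riesz_potential: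
  fixes x b :: "'a::euclidean_space"
  assumes E: "E \<in> sets lborel" "emeasure lborel E < \<infinity>"
    and dist: "\<delta> > 0" "\<And>y. y \<in> E \<Longrightarrow> \<delta> \<le> norm (x - y)"
    and b: "norm b = 1" and q: "q \<ge> 0"
  defines "M \<equiv> restrict_space lborel E"
  shows "derivs2 (\<lambda>s. \<integral>y. norm (x + s *\<^sub>R b - y) powr (- q) \<partial>M)
      (\<integral>y. - q * norm (x - y) powr (- q - 2) * ((x - y) \<bullet> b) \<partial>M)
      (\<integral>y. - q * (- q - 2) * norm (x - y) powr (- q - 4) * ((x - y) \<bullet> b)\<^sup>2 +
         - q * norm (x - y) powr (- q - 2) \<partial>M)"
    and "integrable M (\<lambda>y. - q * (- q - 2) * norm (x - y) powr (- q - 4) * ((x - y) \<bullet> b)\<^sup>2 +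
         - q * norm (x - y) powr (- q - 2))"
proof -
  have fin: "finite_measure M"
    using E unfolding M_def
    by (intro finite_measureI) (auto simp: emeasure_restrict_space space_restrict_space)
  interpret finite_measure M by (rule fin)
  have meas: "g \<in> borel_measurable borel \<Longrightarrow> g \<in> borel_measurable M" for g :: "'a \<Rightarrow> real"
    unfolding M_def by (intro measurable_restrict_space1) simp
  define v where "v s y = (x - y) + s *\<^sub>R b" for s y
  have space: "space M = E" by (simp add: M_def space_restrict_space)
  have v: "\<delta> / 2 \<le> norm (v s y)" "v s y \<noteq> 0" if "\<bar>s\<bar> < \<delta> / 2" "y \<in> space M" for s y
  proof -
    show "\<delta> / 2 \<le> norm (v s y)"
      using dist(2)[of y] that b norm_triangle_ineq4[of "v s y" "s *\<^sub>R b"] by (simp add: v_def space)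
    then show "v s y \<noteq> 0" using dist(1) by auto
  qed
  have le: "norm (v s y) powr p \<le> (\<delta> / 2) powr p" if "\<bar>s\<bar> < \<delta> / 2" "y \<in> space M" "p \<le> 0" for s y p
    using v[OF that(1,2)] dist(1) that(3) by (intro powr_mono2') auto
  have ip: "\<bar>v s y \<bullet> b\<bar> \<le> norm (v s y)" for s y
    using Cauchy_Schwarz_ineq2[of "v s y" b] b by simp
  have ip2: "(v s y \<bullet> b)\<^sup>2 \<le> (norm (v s y))\<^sup>2" for s y
    using ip[of s y] by (metis abs_norm_cancel abs_le_square_iff)
  define f where "f s y = norm (v s y) powr (- q)" for s y
  define f1 where "f1 s y = - q * norm (v s y) powr (- q - 2) * (v s y \<bullet> b)" for s y
  define f2 where "f2 s y = - q * (- q - 2) * norm (v s y) powr (- q - 4) * (v s y \<bullet> b)\<^sup>2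
     + - q * norm (v s y) powr (- q - 2)" for s y
  have m: "f s \<in> borel_measurable M" "f1 s \<in> borel_measurable M" "f2 s \<in> borel_measurable M" for s
    unfolding f_def f1_def f2_def v_def by (auto intro!: meas)
  have b0: "\<bar>f s y\<bar> \<le> (\<delta> / 2) powr (- q)" if "\<bar>s\<bar> < \<delta> / 2" "y \<in> space M" for s y
    using le[OF that] q by (simp add: f_def)
  have b1: "\<bar>f1 s y\<bar> \<le> q * (\<delta> / 2) powr (- q - 1)" if "\<bar>s\<bar> < \<delta> / 2" "y \<in> space M" for s y
  proof -
    have "\<bar>f1 s y\<bar> \<le> q * norm (v s y) powr (- q - 2) * norm (v s y)"
      using q ip[of s y] unfolding f1_def by (auto simp: abs_mult intro!: mult_left_mono)
    also have "\<dots> = q * norm (v s y) powr (- q - 1)"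
      using v[OF that] by (simp add: powr_diff power2_eq_square)
    also have "\<dots> \<le> q * (\<delta> / 2) powr (- q - 1)"
      using le[OF that, of "- q - 1"] q by (intro mult_left_mono) auto
    finally show ?thesis .
  qed
  have b2: "\<bar>f2 s y\<bar> \<le> q * (q + 2) * (\<delta> / 2) powr (- q - 2) + q * (\<delta> / 2) powr (- q - 2)"
    if "\<bar>s\<bar> < \<delta> / 2" "y \<in> space M" for s y
  proof -
    have "\<bar>f2 s y\<bar> \<le> q * (q + 2) * (norm (v s y) powr (- q - 4) * (v s y \<bullet> b)\<^sup>2) + q * norm (v s y) powr (- q - 2)"
      using q unfolding f2_def by (intro order.trans[OF abs_triangle_ineq]) (auto simp: abs_mult algebra_simps)
    also have "norm (v s y) powr (- q - 4) * (v s y \<bullet> b)\<^sup>2 \<le> norm (v s y) powr (- q - 4) * (norm (v s y))\<^sup>2"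
      using ip2 by (intro mult_left_mono) auto
    also have "\<dots> = norm (v s y) powr (- q - 2)"
      using norm_powr_minus2[OF v(2)[OF that], of "- q - 2"] by (simp add: algebra_simps)
    finally have "\<bar>f2 s y\<bar> \<le> q * (q + 2) * norm (v s y) powr (- q - 2) + q * norm (v s y) powr (- q - 2)"
      using q by (auto simp: mult_left_mono)
    also have "\<dots> \<le> q * (q + 2) * (\<delta> / 2) powr (- q - 2) + q * (\<delta> / 2) powr (- q - 2)"
      using le[OF that, of "- q - 2"] q by (intro add_mono mult_left_mono) auto
    finally show ?thesis .
  qed
  have i0: "integrable M (f s)" if "\<bar>s\<bar> < \<delta> / 2" for s
    using b0[OF that] m by (intro integrable_const_bound[of _ "(\<delta> / 2) powr (- q)"]) (auto intro: AE_I2)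
  have i1: "integrable M (f1 s)" if "\<bar>s\<bar> < \<delta> / 2" for s
    using b1[OF that] m by (intro integrable_const_bound[of _ "q * (\<delta> / 2) powr (- q - 1)"]) (auto intro: AE_I2)
  have i2: "integrable M (f2 s)" if "\<bar>s\<bar> < \<delta> / 2" for s
    using b2[OF that] m by (intro integrable_const_bound[OF AE_I2]) auto
  have main: "derivs2 (\<lambda>s. \<integral>y. f s y \<partial>M) (\<integral>y. f1 0 y \<partial>M) (\<integral>y. f2 0 y \<partial>M)"
  proof (rule derivs2I)
    show "((\<lambda>s. \<integral>y. f s y \<partial>M) has_real_derivative (\<integral>y. f1 s y \<partial>M)) (at s)" if "\<bar>s\<bar> < \<delta> / 2" for s
      using fin i0 _ b1 that m(2)
    proof (rule DERIV_integral)
      show "((\<lambda>s. f s y) has_real_derivative f1 s y) (at s)" if "\<bar>s\<bar> < \<delta> / 2" "y \<in> space M" for s y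
        using DERIV_norm_powr_line[OF b, of "x - y" s "- q"] v(2)[OF that] by (simp add: f_def f1_def v_def)
    qed
    show "((\<lambda>s. \<integral>y. f1 s y \<partial>M) has_real_derivative (\<integral>y. f2 0 y \<partial>M)) (at 0)"
      using fin i1 _ b2 _ m(3)
    proof (rule DERIV_integral)
      show "((\<lambda>s. f1 s y) has_real_derivative f2 s y) (at s)" if "\<bar>s\<bar> < \<delta> / 2" "y \<in> space M" for s y
        using DERIV_norm_powr_inner_line[OF b, of "x - y" s "- q"] v(2)[OF that]
        by (simp add: f1_def f2_def v_def)
    qed (use dist(1) in simp_all)
  qed (use dist(1) in simp_all)
  have f_s: "f s = (\<lambda>y. norm (x + s *\<^sub>R b - y) powr (- q))" for s
    by (simp add: f_def v_def fun_eq_iff diff_add_eq)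
  have f1_0: "f1 0 = (\<lambda>y. - q * norm (x - y) powr (- q - 2) * ((x - y) \<bullet> b))"
    by (simp add: f1_def v_def fun_eq_iff)
  have f2_0: "f2 0 = (\<lambda>y. - q * (- q - 2) * norm (x - y) powr (- q - 4) * ((x - y) \<bullet> b)\<^sup>2 +
         - q * norm (x - y) powr (- q - 2))"
    by (simp add: f2_def v_def fun_eq_iff)
  show "derivs2 (\<lambda>s. \<integral>y. norm (x + s *\<^sub>R b - y) powr (- q) \<partial>M)
      (\<integral>y. - q * norm (x - y) powr (- q - 2) * ((x - y) \<bullet> b) \<partial>M)
      (\<integral>y. - q * (- q - 2) * norm (x - y) powr (- q - 4) * ((x - y) \<bullet> b)\<^sup>2 +
         - q * norm (x - y) powr (- q - 2) \<partial>M)"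
    using main unfolding f_s f1_0 f2_0 .
  show "integrable M (\<lambda>y. - q * (- q - 2) * norm (x - y) powr (- q - 4) * ((x - y) \<bullet> b)\<^sup>2 +
         - q * norm (x - y) powr (- q - 2))"
    using i2[of 0] dist(1) f2_0 by simp
qed

lemma laplacian_riesz_potential:
  fixes x :: "'a::euclidean_space"
  assumes E: "E \<in> sets lborel" "emeasure lborel E < \<infinity>"
    and dist: "\<delta> > 0" "\<And>y. y \<in> E \<Longrightarrow> \<delta> \<le> norm (x - y)"
    and q: "q \<ge> 0"
  defines "M \<equiv> restrict_space lborel E"
  shows "(\<Sum>b\<in>Basis. \<integral>y. - q * (- q - 2) * norm (x - y) powr (- q - 4) * ((x - y) \<bullet> b)\<^sup>2 +
         - q * norm (x - y) powr (- q - 2) \<partial>M)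
       = q * (q + 2 - real DIM('a)) * (\<integral>y. norm (x - y) powr (- q - 2) \<partial>M)"
proof -
  have "(\<Sum>b\<in>Basis. \<integral>y. - q * (- q - 2) * norm (x - y) powr (- q - 4) * ((x - y) \<bullet> b)\<^sup>2 +
         - q * norm (x - y) powr (- q - 2) \<partial>M)
     = (\<integral>y. (\<Sum>b\<in>Basis. - q * (- q - 2) * norm (x - y) powr (- q - 4) * ((x - y) \<bullet> b)\<^sup>2 +
         - q * norm (x - y) powr (- q - 2)) \<partial>M)"
    unfolding M_def using derivs2_riesz_potential(2)[OF E dist _ q]
    by (intro integral_sum'[symmetric]) auto
  also have "\<dots> = (\<integral>y. q * (q + 2 - real DIM('a)) * norm (x - y) powr (- q - 2) \<partial>M)"
  proof (rule Bochner_Integration.integral_cong[OF refl])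
    fix y assume "y \<in> space M"
    then have "x - y \<noteq> 0" using dist(1) dist(2)[of y] by (auto simp: M_def space_restrict_space)
    from laplacian_norm_powr[OF this, of "- q"]
    show "(\<Sum>b\<in>Basis. - q * (- q - 2) * norm (x - y) powr (- q - 4) * ((x - y) \<bullet> b)\<^sup>2 +
         - q * norm (x - y) powr (- q - 2)) = q * (q + 2 - real DIM('a)) * norm (x - y) powr (- q - 2)"
      by (simp add: algebra_simps)
  qed
  finally show ?thesis by simp
qed

lemma le_suminf_ennreal: "f k \<le> suminf f" for f :: "nat \<Rightarrow> ennreal"
  using sum_le_suminf[of f "{k}"] by simp

text \<open>A single term is enough: the one with (1/2)^k \<le> |x - y| < 2 (1/2)^k. Balls instead
  of shells make the terms easy to integrate. At x = y the left side is 0, because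
  \<open>0 powr (- q)\<close> is 0 by convention.\<close>

lemma norm_powr_le_dyadic_sum:
  fixes x y :: "'a::euclidean_space"
  assumes "norm (x - y) < 2" "0 \<le> q"
  shows "ennreal (norm (x - y) powr (- q)) \<le>
    (\<Sum>k. ennreal (2 powr (real k * q)) * indicator (ball x (2 * (1/2) ^ k)) y)"
    (is "_ \<le> suminf ?f")
proof (cases "x = y")
  case False
  define k where "k = (LEAST k. (1/2) ^ k \<le> norm (x - y))"
  have "\<exists>k. (1/2::real) ^ k < norm (x - y)"
    using False by (intro real_arch_pow_inv) auto
  then have k: "(1/2) ^ k \<le> norm (x - y)"
    unfolding k_def by (metis (mono_tags, lifting) LeastI_ex less_imp_le)
  have k': "norm (x - y) < 2 * (1/2) ^ k"
  proof (cases k)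
    case (Suc j)
    then have "\<not> (1/2) ^ j \<le> norm (x - y)"
      using not_less_Least[of j "\<lambda>k. (1/2) ^ k \<le> norm (x - y)"] by (simp add: k_def)
    then show ?thesis using Suc by simp
  qed (use assms in simp)
  have "norm (x - y) powr (- q) \<le> ((1/2) ^ k) powr (- q)"
    using k assms by (intro powr_mono2') auto
  also have "((1/2::real) ^ k) powr (- q) = 2 powr (real k * q)"
  proof -
    have "(1/2::real) ^ k = 2 powr (- real k)"
      by (simp add: powr_minus powr_realpow power_one_over inverse_eq_divide)
    then show ?thesis by (simp add: powr_powr)
  qed
  finally have "ennreal (norm (x - y) powr (- q)) \<le> ?f k"
    using k' by (auto simp: dist_norm intro: ennreal_leI)
  also have "\<dots> \<le> suminf ?f"
    by (rule le_suminf_ennreal)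
  finally show ?thesis .
qed simp

text \<open>The kernel has size 2^(k (d - 1)) on a ball of volume about 2^(- k d), so the dyadic
  terms form a geometric series. Points of the unit ball are less than 2 apart, which is why the
  balls start with radius 2.\<close>

lemma riesz_potential_bounded:
  fixes x :: "'a::euclidean_space"
  assumes E: "E \<in> sets lborel" "E \<subseteq> ball 0 1" and x: "norm x < 1"
  shows "(\<integral>y. norm (x - y) powr (- (real DIM('a) - 1)) \<partial>restrict_space lborel E)
    \<le> 2 ^ (DIM('a) + 1) * unit_ball_vol (real DIM('a))"
proof -
  let ?d = "DIM('a)" and ?q = "real DIM('a) - 1" and ?v = "unit_ball_vol (real DIM('a))"
  have q: "?q \<ge> 0" using DIM_positive[where 'a = 'a] by linarith
  let ?f = "\<lambda>k y. ennreal (2 powr (real k * ?q)) * indicator (ball x (2 * (1/2) ^ k)) y"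
  have "(\<integral>\<^sup>+y. ennreal (norm (x - y) powr (- ?q)) \<partial>restrict_space lborel E)
      = (\<integral>\<^sup>+y. ennreal (norm (x - y) powr (- ?q)) * indicator E y \<partial>lborel)"
    using E by (intro nn_integral_restrict_space) auto
  also have "\<dots> \<le> (\<integral>\<^sup>+y. (\<Sum>k. ?f k y) \<partial>lborel)"
  proof (intro nn_integral_mono)
    fix y
    show "ennreal (norm (x - y) powr (- ?q)) * indicator E y \<le> (\<Sum>k. ?f k y)"
    proof (cases "y \<in> E")
      case True
      then have "norm (x - y) < 2"
        using E x norm_triangle_ineq4[of x y] by force
      from norm_powr_le_dyadic_sum[OF this q] True show ?thesis by simp
    qed simp
  qed
  also have "\<dots> = (\<Sum>k. \<integral>\<^sup>+y. ?f k y \<partial>lborel)"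
    by (intro nn_integral_suminf borel_measurable_times_ennreal borel_measurable_indicator) auto
  also have "\<dots> = (\<Sum>k. ennreal (?v * 2 ^ ?d * (1/2) ^ k))"
  proof (intro suminf_cong)
    fix k
    have "(\<integral>\<^sup>+y. ?f k y \<partial>lborel) = ennreal (2 powr (real k * ?q)) * ennreal (?v * (2 * (1/2) ^ k) ^ ?d)"
      by (subst nn_integral_cmult_indicator) (auto simp: emeasure_ball)
    also have "\<dots> = ennreal (2 powr (real k * ?q) * (?v * (2 * (1/2) ^ k) ^ ?d))"
      by (simp add: ennreal_mult)
    also have "2 powr (real k * ?q) * (2 * (1/2) ^ k) ^ ?d = (2::real) ^ ?d * (1/2) ^ k"
    proof -
      have "(2::real) powr (real k * ?q) = 2 ^ (k * ?d) / 2 ^ k"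
        by (simp add: algebra_simps powr_diff powr_realpow[symmetric])
      then show ?thesis
        by (simp add: power_mult_distrib power_mult power_divide power_one_over)
    qed
    then have "2 powr (real k * ?q) * (?v * (2 * (1/2) ^ k) ^ ?d) = ?v * 2 ^ ?d * (1/2) ^ k"
      by (simp add: mult_ac)
    finally show "(\<integral>\<^sup>+y. ?f k y \<partial>lborel) = ennreal (?v * 2 ^ ?d * (1/2) ^ k)" .
  qed
  also have "\<dots> = ennreal (?v * 2 ^ ?d * 2)"
  proof (rule suminf_ennreal_eq)
    have "(\<lambda>k. (1/2::real) ^ k) sums 2"
      using geometric_sums[of "1/2::real"] by simp
    then show "(\<lambda>k. ?v * 2 ^ ?d * (1/2) ^ k) sums (?v * 2 ^ ?d * 2)"
      by (rule sums_mult)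
  qed auto
  finally have "(\<integral>\<^sup>+y. ennreal (norm (x - y) powr (- ?q)) \<partial>restrict_space lborel E)
      \<le> ennreal (2 ^ (?d + 1) * ?v)"
    by (simp add: mult_ac)
  moreover have "(\<integral>y. norm (x - y) powr (- ?q) \<partial>restrict_space lborel E)
      = enn2real (\<integral>\<^sup>+y. ennreal (norm (x - y) powr (- ?q)) \<partial>restrict_space lborel E)"
    by (intro integral_eq_nn_integral measurable_restrict_space1) auto
  ultimately show ?thesis
    by (auto intro!: enn2real_leI)
qed

lemma riesz_potential_lower:
  fixes x :: "'a::euclidean_space"
  assumes E: "E \<in> sets lborel" "emeasure lborel E < \<infinity>"
    and dist: "\<delta> > 0" "\<And>y. y \<in> E \<Longrightarrow> \<delta> \<le> norm (x - y)"
    and p: "p \<le> 0"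
    and G: "G \<in> sets lborel" "G \<subseteq> E" "\<And>y. y \<in> G \<Longrightarrow> norm (x - y) \<le> \<rho>"
  shows "measure lborel G * \<rho> powr p \<le> (\<integral>y. norm (x - y) powr p \<partial>restrict_space lborel E)"
proof -
  let ?M = "restrict_space lborel E"
  interpret finite_measure ?M
    using E by (intro finite_measureI) (auto simp: emeasure_restrict_space space_restrict_space)
  have sets: "G \<in> sets ?M"
    using G E by (simp add: sets_restrict_space_iff)
  have "measure lborel G * \<rho> powr p = (\<integral>y. \<rho> powr p * indicator G y \<partial>?M)"
    using sets E G
    by (simp add: measure_restrict_space space_restrict_space inf.absorb1 Int_absorb2 mult.commute)
  also have "\<dots> \<le> (\<integral>y. norm (x - y) powr p \<partial>?M)"
  proof (rule integral_mono)
    show "integrable ?M (\<lambda>y. \<rho> powr p * indicator G y)"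
      using sets by (intro integrable_mult_right) (simp add: emeasure_eq_measure)
    show "integrable ?M (\<lambda>y. norm (x - y) powr p)"
    proof (rule integrable_const_bound[of _ "\<delta> powr p"])
      show "AE y in ?M. norm (norm (x - y) powr p) \<le> \<delta> powr p"
        using dist p by (intro AE_I2) (auto simp: space_restrict_space intro!: powr_mono2')
    qed (intro measurable_restrict_space1, simp)
    fix y assume "y \<in> space ?M"
    then have "0 < norm (x - y)"
      using dist(1) dist(2)[of y] by (auto simp: space_restrict_space)
    then show "\<rho> powr p * indicator G y \<le> norm (x - y) powr p"
      using G(3)[of y] p by (auto simp: indicator_def intro!: powr_mono2')
  qed
  finally show ?thesis .
qed

section \<open>Surface measure and sectors\<close>

text \<open>The truncated solid cone over \<open>G\<close>. As \<open>sphere_measure\<close> is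
  defined by such a cone of radius 1, sectors translate the density hypothesis into Lebesgue
  measure.\<close>

definition sector :: "'a::euclidean_space set \<Rightarrow> real \<Rightarrow> 'a set" where
  "sector G s = {y. y \<noteq> 0 \<and> norm y < s \<and> y /\<^sub>R norm y \<in> G}"

lemma sets_sector:
  assumes "G \<in> sets borel"
  shows "sector G s \<in> sets lborel"
proof -
  have "(\<lambda>y::'a. y /\<^sub>R norm y) -` G \<inter> space borel \<in> sets borel"
    using assms by (intro measurable_sets[of _ borel borel]) auto
  moreover have "sector G s = ((\<lambda>y. y /\<^sub>R norm y) -` G \<inter> space borel) \<inter> (ball 0 s - {0})"
    by (auto simp: sector_def)
  ultimately show ?thesis
    by (simp add: sets.Int)
qed

lemma emeasure_sector_finite: "emeasure lborel (sector G s) < \<infinity>"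
  for G :: "'a::euclidean_space set"
proof -
  have "emeasure lborel (sector G s) \<le> emeasure lborel (ball (0::'a) s)"
    by (intro emeasure_mono) (auto simp: sector_def)
  then show ?thesis
    using emeasure_lborel_ball_finite order_le_less_trans by blast
qed

lemma measure_sector:
  fixes G :: "'a::euclidean_space set"
  assumes G: "G \<in> sets borel" and s: "0 \<le> s"
  shows "measure lborel (sector G s) = s ^ DIM('a) * measure lborel (sector G 1)"
proof (cases "s = 0")
  case True
  have "sector G s = {}" using True by (auto simp: sector_def)
  then show ?thesis using True by (simp add: zero_power)
next
  case False
  have "sector G s = (\<lambda>x. s *\<^sub>R x + 0) ` sector G 1"
  proof safe
    fix y assume "y \<in> sector G s"
    then have "y /\<^sub>R s \<in> sector G 1" using s False by (simp add: sector_def field_simps)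
    then show "y \<in> (\<lambda>x. s *\<^sub>R x + 0) ` sector G 1"
      using False by (intro image_eqI[of _ _ "y /\<^sub>R s"]) auto
  qed (use s False in \<open>auto simp: sector_def field_simps\<close>)
  then have "measure lebesgue (sector G s) = \<bar>s\<bar> ^ DIM('a) * measure lebesgue (sector G 1)"
    by (simp only: measure_lebesgue_affine)
  then show ?thesis
    using sets_sector[OF G] s by (simp add: measure_completion)
qed

lemma measure_sphere_measure:
  fixes G :: "'a::euclidean_space set"
  assumes G: "G \<in> sets borel" "G \<subseteq> sphere 0 1"
  shows "measure sphere_measure G = real DIM('a) * measure lborel (sector G 1)"
proof -
  let ?R = "restrict_space lborel (ball 0 1 - {0::'a})" and ?S = "restrict_space borel (sphere 0 (1::real) :: 'a set)"
  have sets: "G \<in> sets ?S"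
    using G by (simp add: sets_restrict_space_iff)
  have meas: "(\<lambda>x. x /\<^sub>R norm x) \<in> measurable ?R ?S"
    by (intro measurable_restrict_space2 measurable_restrict_space1)
      (auto simp: space_restrict_space)
  have vim: "(\<lambda>x. x /\<^sub>R norm x) -` G \<inter> space ?R = sector G 1"
    by (auto simp: sector_def space_restrict_space)
  have "emeasure sphere_measure G = ennreal (real DIM('a)) * emeasure (distr ?R ?S (\<lambda>x. x /\<^sub>R norm x)) G"
    unfolding sphere_measure_def using sets by (intro emeasure_density_const) simp
  also have "emeasure (distr ?R ?S (\<lambda>x. x /\<^sub>R norm x)) G = emeasure ?R (sector G 1)"
    using emeasure_distr[OF meas sets] vim by simp
  also have "\<dots> = emeasure lborel (sector G 1)"
    by (intro emeasure_restrict_space) (auto simp: sector_def)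
  finally show ?thesis
    by (simp add: measure_def enn2real_mult)
qed

text \<open>By scaling, the shell fills the fraction 1 - (1 - r)^d of the sector of radius s, and
  this is at least r because (1 - r)^d \<le> 1 - r.\<close>

lemma measure_sector_shell:
  fixes G :: "'a::euclidean_space set"
  assumes G: "G \<in> sets borel" "G \<subseteq> sphere 0 1" and s: "0 < s" and r: "0 < r" "r \<le> 1"
  shows "measure sphere_measure G / real DIM('a) * r * s ^ DIM('a)
    \<le> measure lborel (sector G s - sector G ((1 - r) * s))"
proof -
  let ?m = "measure lborel (sector G 1)"
  have sub: "sector G ((1 - r) * s) \<subseteq> sector G s"
    using s r by (auto simp: sector_def intro: less_le_trans mult_left_le_one_le)
  have "measure lborel (sector G s - sector G ((1 - r) * s))
      = measure lborel (sector G s) - measure lborel (sector G ((1 - r) * s))"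
    using sub emeasure_sector_finite sets_sector[OF G(1)]
    by (intro measure_Diff) (auto simp: less_top)
  also have "\<dots> = s ^ DIM('a) * ?m - ((1 - r) * s) ^ DIM('a) * ?m"
    using s r measure_sector[OF G(1), of s] measure_sector[OF G(1), of "(1 - r) * s"] by simp
  also have "\<dots> = (1 - (1 - r) ^ DIM('a)) * (s ^ DIM('a) * ?m)"
    unfolding power_mult_distrib left_diff_distrib[of 1 "(1 - r) ^ DIM('a)"] mult_1_left mult.assoc ..
  also have "\<dots> \<ge> r * (s ^ DIM('a) * ?m)"
  proof (rule mult_right_mono)
    have "(1 - r) ^ DIM('a) \<le> (1 - r) ^ 1"
      using r DIM_positive[where 'a = 'a] by (intro power_decreasing) auto
    then show "r \<le> 1 - (1 - r) ^ DIM('a)" by simp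
  qed (use s in simp)
  finally show ?thesis
    unfolding measure_sphere_measure[OF G] by (simp add: mult_ac)
qed

section \<open>The comparison principle\<close>

text \<open>Only an upper bound is required; two-sided estimates come from applying this to u and -u.\<close>
definition heat_sol :: "'a::euclidean_space set \<Rightarrow> (real \<times> 'a \<Rightarrow> real) \<Rightarrow> real \<Rightarrow> bool" where
  "heat_sol \<Omega> u K \<longleftrightarrow>
     continuous_on ({0<..<1} \<times> (\<Omega> \<inter> ball 0 1)) u \<and>
     (\<forall>t\<in>{0<..<1}. \<forall>x\<in>\<Omega> \<inter> ball 0 1. \<exists>p q.
        ((\<lambda>s. u (s, x)) has_real_derivative (\<Sum>b\<in>Basis. q b)) (at t) \<and>
        (\<forall>b\<in>Basis. derivs2 (\<lambda>s. u (t, x + s *\<^sub>R b)) (p b) (q b))) \<and>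
     (\<forall>t\<in>{0<..<1}. \<forall>x\<in>frontier \<Omega> \<inter> ball 0 1.
        (u \<longlongrightarrow> 0) (at (t, x) within {0<..<1} \<times> (\<Omega> \<inter> ball 0 1))) \<and>
     (\<forall>t\<in>{0<..<1}. \<forall>x\<in>\<Omega> \<inter> ball 0 1. u (t, x) \<le> K)"

text \<open>If u - \<Phi> were positive somewhere, a superlevel set of it would be compact and it
  would attain its maximum off the bottom and the sphere |x - x0| = r. There the second derivative
  test and the sign of the time derivative contradict the strict inequality for \<Phi>.\<close>

lemma heat_comparison:
  fixes x0 :: "'a::euclidean_space"
  assumes \<Omega>: "open \<Omega>" and u: "heat_sol \<Omega> u K"
    and cyl: "0 < r" "cball x0 r \<subseteq> ball 0 1" "0 < t0 - r\<^sup>2" "t0 < 1"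
    and cont: "continuous_on ({t0 - r\<^sup>2..t0} \<times> (\<Omega> \<inter> cball x0 r)) \<Phi>"
    and nonneg: "\<And>t x. t \<in> {t0 - r\<^sup>2..t0} \<Longrightarrow> x \<in> \<Omega> \<inter> cball x0 r \<Longrightarrow> 0 \<le> \<Phi> (t, x)"
    and super: "\<And>t x. t \<in> {t0 - r\<^sup>2<..t0} \<Longrightarrow> x \<in> \<Omega> \<inter> ball x0 r \<Longrightarrow> \<exists>\<tau> p q.
        ((\<lambda>s. \<Phi> (s, x)) has_real_derivative \<tau>) (at t) \<and>
        (\<forall>b\<in>Basis. derivs2 (\<lambda>s. \<Phi> (t, x + s *\<^sub>R b)) (p b) (q b)) \<and> (\<Sum>b\<in>Basis. q b) < \<tau>"
    and bdry: "\<And>t x. t \<in> {t0 - r\<^sup>2..t0} \<Longrightarrow> x \<in> \<Omega> \<inter> cball x0 r \<Longrightarrow>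
        t = t0 - r\<^sup>2 \<or> dist x0 x = r \<Longrightarrow> u (t, x) \<le> \<Phi> (t, x)"
    and pt: "t1 \<in> {t0 - r\<^sup>2..t0}" "x1 \<in> \<Omega> \<inter> cball x0 r"
  shows "u (t1, x1) \<le> \<Phi> (t1, x1)"
proof (rule ccontr)
  assume "\<not> u (t1, x1) \<le> \<Phi> (t1, x1)"
  define A where "A = {0<..<1::real} \<times> (\<Omega> \<inter> ball 0 1)"
  define D where "D = {t0 - r\<^sup>2..t0} \<times> (\<Omega> \<inter> cball x0 r)"
  define v where "v = (\<lambda>p. u p - \<Phi> p)"
  define m where "m = v (t1, x1)"
  define S where "S = {p \<in> D. m \<le> v p}"
  have m: "0 < m"
    using \<open>\<not> u (t1, x1) \<le> \<Phi> (t1, x1)\<close> by (simp add: m_def v_def)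
  have DA: "D \<subseteq> A"
    using cyl by (auto simp: A_def D_def)
  have cont_v: "continuous_on D v"
    using u cont continuous_on_subset[OF _ DA, of u]
    unfolding v_def D_def A_def heat_sol_def by (intro continuous_on_diff) auto
  \<comment> \<open>A limit of points of \<open>S\<close> could leave \<Omega> only through the
    frontier, where u tends to 0; but u \<ge> \<Phi> + m \<ge> m > 0 along the sequence.\<close>
  have "closed S"
    unfolding closed_sequential_limits
  proof (intro allI impI, elim conjE)
    fix X l assume X: "\<forall>n. X n \<in> S" and lim: "X \<longlonglongrightarrow> l"
    have XD: "X n \<in> D" and Xm: "m \<le> v (X n)" for n
      using X by (auto simp: S_def)
    obtain t x where l: "l = (t, x)" by (cases l)
    have limt: "(\<lambda>n. fst (X n)) \<longlonglongrightarrow> t" and limx: "(\<lambda>n. snd (X n)) \<longlonglongrightarrow> x"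
      using tendsto_fst[OF lim] tendsto_snd[OF lim] l by auto
    have t: "t \<in> {t0 - r\<^sup>2..t0}"
      by (rule closed_sequentially[OF closed_atLeastAtMost _ limt]) (use XD in \<open>auto simp: D_def mem_Times_iff\<close>)
    have x: "x \<in> cball x0 r"
      by (rule closed_sequentially[OF closed_cball _ limx]) (use XD in \<open>auto simp: D_def mem_Times_iff\<close>)
    have x\<Omega>: "snd (X n) \<in> \<Omega>" for n
      using XD[of n] by (auto simp: D_def)
    have "x \<in> \<Omega>"
    proof (rule ccontr)
      assume "x \<notin> \<Omega>"
      moreover have "x \<in> closure \<Omega>"
        unfolding closure_sequential using x\<Omega> limx by (intro exI[of _ "\<lambda>n. snd (X n)"]) simp
      ultimately have "x \<in> frontier \<Omega>"
        using \<Omega> by (simp add: frontier_def interior_open)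
      then have "(u \<longlongrightarrow> 0) (at (t, x) within A)"
        using u t x cyl unfolding heat_sol_def A_def by (auto dest: subsetD)
      moreover have "\<forall>n. X n \<in> A - {(t, x)}"
        using XD DA x\<Omega> \<open>x \<notin> \<Omega>\<close> by (metis Diff_iff singletonD snd_conv subsetD)
      ultimately have "(\<lambda>n. u (X n)) \<longlonglongrightarrow> 0"
        using lim l unfolding tendsto_at_iff_sequentially o_def by blast
      moreover have "m \<le> u (X n)" for n
        using Xm[of n] XD[of n] nonneg[of "fst (X n)" "snd (X n)"] by (auto simp: v_def D_def)
      ultimately show False
        using m LIMSEQ_le_const[of "\<lambda>n. u (X n)" 0 m] by auto
    qed
    then have lD: "l \<in> D"
      using t x l by (auto simp: D_def)
    then have "(\<lambda>n. v (X n)) \<longlonglongrightarrow> v l"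
      using cont_v XD lim unfolding continuous_on_sequentially o_def by blast
    then have "m \<le> v l"
      using Xm by (intro LIMSEQ_le_const) auto
    with lD show "l \<in> S" by (simp add: S_def)
  qed
  moreover have "bounded S"
    by (rule bounded_subset[of "{t0 - r\<^sup>2..t0} \<times> cball x0 r"])
      (auto simp: S_def D_def intro!: bounded_Times)
  ultimately have "compact S" by (simp add: compact_eq_bounded_closed)
  moreover have "(t1, x1) \<in> S"
    using pt by (auto simp: S_def D_def m_def)
  moreover have "continuous_on S v"
    using cont_v by (rule continuous_on_subset) (auto simp: S_def)
  ultimately obtain p where p: "p \<in> S" "\<And>z. z \<in> S \<Longrightarrow> v z \<le> v p"
    using continuous_attains_sup[of S v] by blast
  obtain t x where tx: "p = (t, x)" by (cases p)
  have mp: "m \<le> v (t, x)" and pD: "(t, x) \<in> D"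
    using p tx by (auto simp: S_def)
  have max: "v z \<le> v (t, x)" if "z \<in> D" for z
    using p(2)[of z] that mp tx by (cases "m \<le> v z") (auto simp: S_def)
  have tin: "t \<in> {t0 - r\<^sup>2..t0}" and xin: "x \<in> \<Omega> \<inter> cball x0 r"
    using pD by (auto simp: D_def)
  have "\<not> (t = t0 - r\<^sup>2 \<or> dist x0 x = r)"
    using bdry[OF tin xin] mp m by (auto simp: v_def)
  then have t': "t \<in> {t0 - r\<^sup>2<..t0}" and x': "x \<in> \<Omega> \<inter> ball x0 r"
    using tin xin by (auto simp: less_le)
  obtain \<tau> p' q' where \<Phi>: "((\<lambda>s. \<Phi> (s, x)) has_real_derivative \<tau>) (at t)"
      "\<And>b. b \<in> Basis \<Longrightarrow> derivs2 (\<lambda>s. \<Phi> (t, x + s *\<^sub>R b)) (p' b) (q' b)" "(\<Sum>b\<in>Basis. q' b) < \<tau>"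
    using super[OF t' x'] by blast
  have "(t, x) \<in> A" using pD DA by blast
  then obtain p2 q2 where U: "((\<lambda>s. u (s, x)) has_real_derivative (\<Sum>b\<in>Basis. q2 b)) (at t)"
      "\<And>b. b \<in> Basis \<Longrightarrow> derivs2 (\<lambda>s. u (t, x + s *\<^sub>R b)) (p2 b) (q2 b)"
    using u unfolding heat_sol_def A_def by blast
  have "(\<Sum>b\<in>Basis. q2 b) \<le> (\<Sum>b\<in>Basis. q' b)"
  proof (rule sum_mono)
    fix b :: 'a assume b: "b \<in> Basis"
    have "derivs2 (\<lambda>s. v (t, x + s *\<^sub>R b)) (p2 b + - p' b) (q2 b + - q' b)"
      using derivs2_add[OF U(2)[OF b] derivs2_uminus[OF \<Phi>(2)[OF b]]] by (simp add: v_def)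
    moreover have "\<forall>\<^sub>F s in nhds 0. v (t, x + s *\<^sub>R b) \<le> v (t, x + 0 *\<^sub>R b)"
    proof -
      have lim: "filterlim (\<lambda>s. x + s *\<^sub>R b) (nhds x) (nhds 0)"
        by (rule tendsto_eq_intros tendsto_ident_at filterlim_ident refl | simp)+
      have "open (\<Omega> \<inter> ball x0 r)" using \<Omega> by auto
      from eventually_compose_filterlim[OF eventually_nhds_in_open[OF this x'] lim]
      show ?thesis
        by eventually_elim (use max tin in \<open>auto simp: D_def\<close>)
    qed
    ultimately show "q2 b \<le> q' b"
      using derivs2_local_max by fastforce
  qed
  \<comment> \<open>The maximum may sit on the top t = t0, so only earlier times are compared: a
    negative time derivative would make \<open>v\<close> larger just before.\<close>
  moreover have "0 \<le> (\<Sum>b\<in>Basis. q2 b) - \<tau>"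
  proof (rule ccontr)
    assume "\<not> 0 \<le> (\<Sum>b\<in>Basis. q2 b) - \<tau>"
    then obtain d where d: "d > 0" "\<And>h. 0 < h \<Longrightarrow> h < d \<Longrightarrow> v (t, x) < v (t - h, x)"
      using DERIV_neg_dec_left[OF DERIV_diff[OF U(1) \<Phi>(1)]] by (auto simp: v_def)
    define h where "h = min d (t - (t0 - r\<^sup>2)) / 2"
    have h: "0 < h" "h < d" "t - h \<in> {t0 - r\<^sup>2..t0}"
      using d(1) t' by (auto simp: h_def min_def field_simps)
    then show False
      using d(2)[of h] max[of "(t - h, x)"] xin by (auto simp: D_def)
  qed
  ultimately show False using \<Phi>(3) by linarith
qed

section \<open>Products of powers and their logarithmic derivatives\<close>

text \<open>Since log (k^a l^c) = a log k + c log l, the second derivative is \<phi> times the sum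
  of \<open>Z\<^sup>2\<close> and the second derivative of this logarithm. The latter consists of
  the two negative squares and of the terms in \<open>e\<close> and \<open>e'\<close>, which will
  add up to the Laplacians of the factors.\<close>

lemma derivs2_powr_mult:
  fixes a c :: real
  assumes k: "derivs2 k d e" "k 0 > 0" and l: "derivs2 l d' e'" "l 0 > 0"
  defines "\<phi> \<equiv> k 0 powr a * l 0 powr c" and "Z \<equiv> a * (d / k 0) + c * (d' / l 0)"
  shows "derivs2 (\<lambda>s. k s powr a * l s powr c) (\<phi> * Z)
    (\<phi> * (Z\<^sup>2 - a * (d / k 0)\<^sup>2 - c * (d' / l 0)\<^sup>2 + a * e / k 0 + c * e' / l 0))"
proof -
  have "derivs2 (\<lambda>s. k s powr a * l s powr c)
    (a * k 0 powr (a - 1) * d * l 0 powr c + k 0 powr a * (c * l 0 powr (c - 1) * d'))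
    ((a * (a - 1) * k 0 powr (a - 2) * d\<^sup>2 + a * k 0 powr (a - 1) * e) * l 0 powr c
      + 2 * (a * k 0 powr (a - 1) * d) * (c * l 0 powr (c - 1) * d')
      + k 0 powr a * (c * (c - 1) * l 0 powr (c - 2) * d'\<^sup>2 + c * l 0 powr (c - 1) * e'))"
    by (rule derivs2_mult[OF derivs2_powr[OF k] derivs2_powr[OF l]])
  moreover have "a * k 0 powr (a - 1) * d * l 0 powr c + k 0 powr a * (c * l 0 powr (c - 1) * d') = \<phi> * Z"
    using k(2) l(2) by (simp add: \<phi>_def Z_def powr_diff field_simps)
  moreover have "(a * (a - 1) * k 0 powr (a - 2) * d\<^sup>2 + a * k 0 powr (a - 1) * e) * l 0 powr c
      + 2 * (a * k 0 powr (a - 1) * d) * (c * l 0 powr (c - 1) * d')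
      + k 0 powr a * (c * (c - 1) * l 0 powr (c - 2) * d'\<^sup>2 + c * l 0 powr (c - 1) * e')
    = \<phi> * (Z\<^sup>2 - a * (d / k 0)\<^sup>2 - c * (d' / l 0)\<^sup>2 + a * e / k 0 + c * e' / l 0)"
    using k(2) l(2) by (simp add: \<phi>_def Z_def powr_diff power2_eq_square field_simps)
  ultimately show ?thesis by simp
qed

text \<open>This is the Cauchy-Schwarz inequality with weights a and c, whose defect is a c (X -
  Y)^2. For a + c < 1 the right-hand coefficient is negative.\<close>

lemma weighted_square_convex:
  fixes a c X Y :: real
  assumes "0 \<le> a" "0 < c"
  shows "(a * X + c * Y)\<^sup>2 - a * X\<^sup>2 - c * Y\<^sup>2 \<le> - (1 / (a + c) - 1) * (a * X + c * Y)\<^sup>2"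
proof -
  have "(a + c) * (a * X\<^sup>2 + c * Y\<^sup>2) - (a * X + c * Y)\<^sup>2 = a * c * (X - Y)\<^sup>2"
    by (simp add: power2_eq_square algebra_simps)
  moreover have "0 \<le> a * c * (X - Y)\<^sup>2" using assms by simp
  ultimately have "(a * X + c * Y)\<^sup>2 \<le> (a * X\<^sup>2 + c * Y\<^sup>2) * (a + c)"
    by (simp only: mult.commute)
  then have "(a * X + c * Y)\<^sup>2 / (a + c) \<le> a * X\<^sup>2 + c * Y\<^sup>2"
    using assms by (subst pos_divide_le_eq) auto
  then show ?thesis by (simp add: algebra_simps)
qed

section \<open>Improving the exponent\<close>

text \<open>All radii are quantified together because the improved bound at \<open>R\<close> is
  derived from the old one at the larger radius (1 + R) / 2; \<open>N\<close> precedes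
  \<open>u\<close>, so it depends on no solution.\<close>

definition heat_bound :: "'a::euclidean_space set \<Rightarrow> ('a \<Rightarrow> real) \<Rightarrow> real \<Rightarrow> bool" where
  "heat_bound \<Omega> W a \<longleftrightarrow> (\<forall>R. 0 < R \<and> R < 1 \<longrightarrow> (\<exists>N>0. \<forall>u K. 0 < K \<longrightarrow> heat_sol \<Omega> u K \<longrightarrow>
     (\<forall>t x. 1 - R\<^sup>2 < t \<and> t < 1 \<and> x \<in> \<Omega> \<inter> ball 0 R \<longrightarrow> u (t, x) \<le> N * K * W x powr a)))"

text \<open>Separates the improvement of the exponent from the geometry of cones. Here \<rho> is
  just a positive weight; it is instantiated by \<open>bdist\<close>.\<close>

locale barrier_domain =
  fixes \<Omega> :: "'a::euclidean_space set" and W h \<rho> :: "'a \<Rightarrow> real" and H \<kappa> :: real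
  assumes \<Omega>: "open \<Omega>"
    and W_pos: "\<And>x. x \<in> \<Omega> \<inter> ball 0 1 \<Longrightarrow> 0 < W x"
    and W_cont: "continuous_on (\<Omega> \<inter> ball 0 1) W"
    and W_harmonic: "\<And>x. x \<in> \<Omega> \<inter> ball 0 1 \<Longrightarrow> \<exists>p q.
        (\<forall>b\<in>Basis. derivs2 (\<lambda>s. W (x + s *\<^sub>R b)) (p b) (q b)) \<and> (\<Sum>b\<in>Basis. q b) = 0"
    and h_bounds: "\<And>x. x \<in> \<Omega> \<inter> ball 0 1 \<Longrightarrow> 1 \<le> h x \<and> h x \<le> H"
    and h_cont: "continuous_on (\<Omega> \<inter> ball 0 1) h"
    and \<kappa>: "0 < \<kappa>"
    and \<rho>: "\<And>x. x \<in> \<Omega> \<inter> ball 0 1 \<Longrightarrow> 0 < \<rho> x"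
    and h_superharmonic: "\<And>x. x \<in> \<Omega> \<inter> ball 0 1 \<Longrightarrow> \<exists>p q.
        (\<forall>b\<in>Basis. derivs2 (\<lambda>s. h (x + s *\<^sub>R b)) (p b) (q b)) \<and> (\<Sum>b\<in>Basis. q b) \<le> - (\<kappa> / \<rho> x)"
begin

definition barrier :: "real \<Rightarrow> real \<Rightarrow> 'a \<Rightarrow> real" where
  "barrier a c x = W x powr a * h x powr c"

lemma barrier_pos:
  assumes "x \<in> \<Omega> \<inter> ball 0 1"
  shows "0 < barrier a c x"
  using W_pos[OF assms] h_bounds[OF assms] by (simp add: barrier_def)

lemma barrier_cont: "continuous_on (\<Omega> \<inter> ball 0 1) (barrier a c)"
  unfolding barrier_def[abs_def] using W_pos h_bounds
  by (intro continuous_on_mult continuous_on_powr W_cont h_cont continuous_on_const) force+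

lemma powr_le_barrier:
  assumes "x \<in> \<Omega> \<inter> ball 0 1" "0 \<le> c"
  shows "W x powr a \<le> barrier a c x"
  using h_bounds[OF assms(1)] assms(2) mult_left_mono[of 1 "h x powr c" "W x powr a"]
  by (simp add: barrier_def ge_one_powr_ge_zero)

lemma barrier_le:
  assumes "x \<in> \<Omega> \<inter> ball 0 1" "0 \<le> c"
  shows "barrier a c x \<le> H powr c * W x powr a"
  using h_bounds[OF assms(1)] assms(2)
  unfolding barrier_def by (subst mult.commute) (intro mult_right_mono powr_mono2, auto)

text \<open>Strict convexity of the exponent (a + c < 1) leaves a negative multiple of the squared
  logarithmic gradient Z, which later absorbs the cross term with a cut-off function.\<close>
lemma barrier_superharmonic:
  assumes x: "x \<in> \<Omega> \<inter> ball 0 1" and a: "0 \<le> a" "0 < c"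
  obtains Z e where "\<And>b. b \<in> Basis \<Longrightarrow>
      derivs2 (\<lambda>s. barrier a c (x + s *\<^sub>R b)) (barrier a c x * Z b) (e b)"
    "(\<Sum>b\<in>Basis. e b) \<le>
       barrier a c x * (- (1 / (a + c) - 1) * (\<Sum>b\<in>Basis. (Z b)\<^sup>2) - c * \<kappa> / (H * \<rho> x))"
proof -
  obtain p q where W: "\<And>b. b \<in> Basis \<Longrightarrow> derivs2 (\<lambda>s. W (x + s *\<^sub>R b)) (p b) (q b)"
      "(\<Sum>b\<in>Basis. q b) = 0"
    using W_harmonic[OF x] by blast
  obtain p' q' where h: "\<And>b. b \<in> Basis \<Longrightarrow> derivs2 (\<lambda>s. h (x + s *\<^sub>R b)) (p' b) (q' b)"
      "(\<Sum>b\<in>Basis. q' b) \<le> - (\<kappa> / \<rho> x)"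
    using h_superharmonic[OF x] by blast
  note Wp = W_pos[OF x] and hb = h_bounds[OF x] and \<rho>p = \<rho>[OF x]
  define X where "X b = p b / W x" for b
  define Y where "Y b = p' b / h x" for b
  define Z where "Z b = a * X b + c * Y b" for b
  define f where "f b = (Z b)\<^sup>2 - a * (X b)\<^sup>2 - c * (Y b)\<^sup>2 + a * q b / W x + c * q' b / h x" for b
  show ?thesis
  proof (rule that)
    fix b :: 'a assume b: "b \<in> Basis"
    show "derivs2 (\<lambda>s. barrier a c (x + s *\<^sub>R b)) (barrier a c x * Z b) (barrier a c x * f b)"
      using derivs2_powr_mult[OF W(1)[OF b] _ h(1)[OF b], of a c] Wp hb
      by (simp add: barrier_def X_def Y_def Z_def f_def)
  next
    have "(\<Sum>b\<in>Basis. f b) \<le> (\<Sum>b\<in>Basis. - (1 / (a + c) - 1) * (Z b)\<^sup>2 + a / W x * q b + c / h x * q' b)"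
      using weighted_square_convex[OF a] by (intro sum_mono) (simp add: f_def Z_def)
    \<comment> \<open>The terms a q b / W x cancel in the sum because W is harmonic; only the
      Laplacian of h survives.\<close>
    also have "\<dots> = - (1 / (a + c) - 1) * (\<Sum>b\<in>Basis. (Z b)\<^sup>2) + c / h x * (\<Sum>b\<in>Basis. q' b)"
      unfolding sum.distrib sum_distrib_left[symmetric] W(2) by simp
    also have "c / h x * (\<Sum>b\<in>Basis. q' b) \<le> c / h x * (- (\<kappa> / \<rho> x))"
      using h(2) a hb by (intro mult_left_mono) auto
    also have "\<dots> \<le> - (c * \<kappa> / (H * \<rho> x))"
    proof -
      have "c * \<kappa> / (H * \<rho> x) \<le> c * \<kappa> / (h x * \<rho> x)"
        using a hb \<kappa> \<rho>p by (intro divide_left_mono mult_right_mono mult_pos_pos) auto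
      then show ?thesis by simp
    qed
    finally have "(\<Sum>b\<in>Basis. f b) \<le> - (1 / (a + c) - 1) * (\<Sum>b\<in>Basis. (Z b)\<^sup>2) - c * \<kappa> / (H * \<rho> x)"
      by simp
    from mult_left_mono[OF this, of "barrier a c x"] barrier_pos[OF x, of a c]
    show "(\<Sum>b\<in>Basis. barrier a c x * f b) \<le>
       barrier a c x * (- (1 / (a + c) - 1) * (\<Sum>b\<in>Basis. (Z b)\<^sup>2) - c * \<kappa> / (H * \<rho> x))"
      by (simp flip: sum_distrib_left)
  qed
qed

text \<open>The first term is the cross term 2 grad \<eta> . Z, with grad \<eta> = 2 z / r^2. As
  \<eta> dominates |z|^2 / r^2, where \<eta> is small z is small too, so the negative square
  weighted by \<eta> still absorbs it: completing the square in k D - 2, with D the inner product of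
  z and Z, leaves a constant independent of \<eta>.\<close>

lemma cut_off_estimate:
  fixes z :: 'a
  assumes "0 < k" "0 < r" "(norm z)\<^sup>2 / r\<^sup>2 \<le> \<eta>"
  shows "4 / r\<^sup>2 * (\<Sum>b\<in>Basis. (z \<bullet> b) * Z b) - \<eta> * k * (\<Sum>b\<in>Basis. (Z b)\<^sup>2) \<le> 4 / (k * r\<^sup>2)"
proof -
  let ?D = "\<Sum>b\<in>Basis. (z \<bullet> b) * Z b" and ?S = "\<Sum>b\<in>Basis. (Z b)\<^sup>2"
  have "?D\<^sup>2 \<le> (norm z)\<^sup>2 * ?S"
    using Cauchy_Schwarz_ineq_sum[of "\<lambda>b. z \<bullet> b" Z Basis] by (simp add: sum_Basis_power2)
  then have "k * (?D\<^sup>2 / r\<^sup>2) \<le> k * ((norm z)\<^sup>2 / r\<^sup>2 * ?S)"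
    using assms by (intro mult_left_mono) (auto simp: divide_right_mono)
  also have "\<dots> \<le> k * (\<eta> * ?S)"
    using assms by (intro mult_left_mono mult_right_mono sum_nonneg) auto
  finally have 1: "k * (?D\<^sup>2 / r\<^sup>2) \<le> \<eta> * k * ?S" by (simp add: mult_ac)
  have "0 \<le> (k * ?D - 2)\<^sup>2 / (k * r\<^sup>2)" using assms by simp
  also have "\<dots> = k * (?D\<^sup>2 / r\<^sup>2) - 4 / r\<^sup>2 * ?D + 4 / (k * r\<^sup>2)"
    using assms by (simp add: field_simps power2_eq_square)
  finally show ?thesis using 1 by linarith
qed

lemma derivs2_dist_sq:
  fixes x x0 b :: 'a
  assumes "b \<in> Basis"
  shows "derivs2 (\<lambda>s. ((norm (x + s *\<^sub>R b - x0))\<^sup>2 + t) / r\<^sup>2) (2 * ((x - x0) \<bullet> b) / r\<^sup>2) (2 / r\<^sup>2)"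
proof -
  have "(norm (x + s *\<^sub>R b - x0))\<^sup>2 = (norm (x - x0))\<^sup>2 + 2 * ((x - x0) \<bullet> b) * s + s\<^sup>2" for s
    using assms unfolding power2_norm_eq_inner
    by (simp add: inner_add_left inner_add_right inner_diff_left inner_diff_right inner_commute
        power2_eq_square algebra_simps)
  then have "derivs2 (\<lambda>s. (norm (x + s *\<^sub>R b - x0))\<^sup>2 + t) (2 * ((x - x0) \<bullet> b)) 2"
    by (auto intro!: derivs2I[where r = 1 and g = "\<lambda>s. 2 * ((x - x0) \<bullet> b) + 2 * s"] derivative_eq_intros)
  from derivs2_cmult[OF this, of "1 / r\<^sup>2"] show ?thesis by simp
qed

lemma heat_bound_step:
  assumes a: "0 \<le> a" "0 < \<gamma>" "0 < c" "a + \<gamma> + c < 1"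
    and W\<rho>: "0 < c2" "\<And>x. x \<in> \<Omega> \<inter> ball 0 1 \<Longrightarrow> c2 * \<rho> x \<le> W x powr \<gamma>"
    and bound: "heat_bound \<Omega> W a"
  shows "heat_bound \<Omega> W (a + \<gamma>)"
  unfolding heat_bound_def
proof (intro allI impI, elim conjE)
  fix R :: real assume R: "0 < R" "R < 1"
  \<comment> \<open>Cylinders of radius r below points of the smaller cylinder must stay in the one
    of radius R'. In space this is R + r = R', in time it is R^2 + r^2 \<le> R'^2.\<close>
  define R' where "R' = (1 + R) / 2"
  define r where "r = R' - R"
  have R': "0 < R'" "R' < 1" "0 < r" "R < R'" "R + r = R'" and r2: "R\<^sup>2 + r\<^sup>2 \<le> R'\<^sup>2"
    using R by (auto simp: R'_def r_def power2_eq_square field_simps)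
  have R'1: "R'\<^sup>2 < 1" using R' by (simp add: power_less_one_iff)
  obtain N where N: "0 < N" "\<And>u K t x. 0 < K \<Longrightarrow> heat_sol \<Omega> u K \<Longrightarrow> 1 - R'\<^sup>2 < t \<Longrightarrow> t < 1 \<Longrightarrow>
      x \<in> \<Omega> \<inter> ball 0 R' \<Longrightarrow> u (t, x) \<le> N * K * W x powr a"
    using bound R' unfolding heat_bound_def by meson
  show "\<exists>N>0. \<forall>u K. 0 < K \<longrightarrow> heat_sol \<Omega> u K \<longrightarrow>
     (\<forall>t x. 1 - R\<^sup>2 < t \<and> t < 1 \<and> x \<in> \<Omega> \<inter> ball 0 R \<longrightarrow> u (t, x) \<le> N * K * W x powr (a + \<gamma>))"
  proof (cases "\<Omega> \<inter> ball 0 R = {}")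
    case True
    then show ?thesis by (intro exI[of _ 1]) auto
  next
    case False
    \<comment> \<open>A point of the nonempty set witnesses 1 \<le> h x \<le> H.\<close>
    then have H: "1 \<le> H" using h_bounds R by force
    define k where "k = 1 / (a + c) - 1"
    have k: "0 < k" using a by (simp add: k_def)
    \<comment> \<open>\<open>L\<close> collects what the cut-off costs: 2 d / r^2 from the Laplacian
      of \<eta>, 1 / r^2 from its time derivative and 4 / (k r^2) from the cross term.
      \<open>B\<close> is chosen so that B c \<kappa> c2 / H = L + 1, the extra 1 giving
      strictness.\<close>
    define L where "L = (2 * real DIM('a) + 1) / r\<^sup>2 + 4 / (k * r\<^sup>2)"
    define B where "B = (L + 1) * H / (c * \<kappa> * c2)"
    have L: "0 < L" using k R' by (simp add: L_def add_pos_pos)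
    have B: "0 < B" using L H a \<kappa> W\<rho>(1) by (simp add: B_def)
    show ?thesis
    proof (intro exI[of _ "N * B * H powr c"] conjI allI impI, goal_cases)
      case 1
      then show ?case using N B H by simp
    next
      case (2 u K t0 x0)
      then have K: "0 < K" and u: "heat_sol \<Omega> u K" and t0: "1 - R\<^sup>2 < t0" "t0 < 1"
        and x0: "x0 \<in> \<Omega>" "norm x0 < R" by auto
      have sub: "cball x0 r \<subseteq> ball 0 R'"
      proof
        fix x assume "x \<in> cball x0 r"
        then show "x \<in> ball 0 R'"
          using x0 R' norm_triangle_ineq2[of x x0] by (auto simp: dist_norm norm_minus_commute)
      qed
      have inball: "x \<in> \<Omega> \<inter> ball 0 1" if "x \<in> \<Omega> \<inter> cball x0 r" for x
        using that sub R' by force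
      have t0r: "1 - R'\<^sup>2 < t0 - r\<^sup>2" using t0 r2 by linarith
      define \<eta> where "\<eta> t x = ((norm (x - x0))\<^sup>2 + (t0 - t)) / r\<^sup>2" for t x
      define \<Phi> where "\<Phi> = (\<lambda>(t, x). N * K * (\<eta> t x * barrier a c x + B * barrier (a + \<gamma>) c x))"
      have \<eta>0: "0 \<le> \<eta> t x" if "t \<le> t0" for t x
        using that by (simp add: \<eta>_def)
      have "u (t0, x0) \<le> \<Phi> (t0, x0)"
        using \<Omega> u R'(3) _ _ t0(2)
      proof (rule heat_comparison)
        show "cball x0 r \<subseteq> ball 0 1" using sub R' by force
        show "0 < t0 - r\<^sup>2" using t0r R'1 by linarith
        have cont: "continuous_on ({t0 - r\<^sup>2..t0} \<times> (\<Omega> \<inter> cball x0 r)) (\<lambda>p. barrier a c (snd p))" for a c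
          by (rule continuous_on_compose2[OF barrier_cont continuous_on_snd[OF continuous_on_id]])
            (use inball in auto)
        show "continuous_on ({t0 - r\<^sup>2..t0} \<times> (\<Omega> \<inter> cball x0 r)) \<Phi>"
          unfolding \<Phi>_def case_prod_beta \<eta>_def
          using R' by (intro continuous_intros cont) auto
        show "0 \<le> \<Phi> (t, x)" if "t \<in> {t0 - r\<^sup>2..t0}" "x \<in> \<Omega> \<inter> cball x0 r" for t x
          using that N K B \<eta>0[of t x] barrier_pos[OF inball[OF that(2)], THEN less_imp_le]
          by (auto simp: \<Phi>_def intro!: mult_nonneg_nonneg add_nonneg_nonneg)
        show "t0 \<in> {t0 - r\<^sup>2..t0}" "x0 \<in> \<Omega> \<inter> cball x0 r" using x0 R' by auto
      next
        fix t x assume t: "t \<in> {t0 - r\<^sup>2..t0}" and x: "x \<in> \<Omega> \<inter> cball x0 r"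
          and edge: "t = t0 - r\<^sup>2 \<or> dist x0 x = r"
        have "1 \<le> \<eta> t x"
          using edge t R'(3) by (auto simp: \<eta>_def dist_norm norm_minus_commute)
        have "u (t, x) \<le> N * K * W x powr a"
          using t x sub t0 t0r by (intro N(2) K u) auto
        also have "\<dots> \<le> N * K * (\<eta> t x * barrier a c x + B * barrier (a + \<gamma>) c x)"
        proof (intro mult_left_mono)
          have "W x powr a \<le> 1 * barrier a c x"
            using powr_le_barrier[OF inball[OF x], of c a] a by simp
          also have "\<dots> \<le> \<eta> t x * barrier a c x"
            using \<open>1 \<le> \<eta> t x\<close> barrier_pos[OF inball[OF x], of a c] by (intro mult_right_mono) auto
          also have "\<dots> \<le> \<eta> t x * barrier a c x + B * barrier (a + \<gamma>) c x"
            using B barrier_pos[OF inball[OF x], of "a + \<gamma>" c] by simp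
          finally show "W x powr a \<le> \<eta> t x * barrier a c x + B * barrier (a + \<gamma>) c x" .
        qed (use N K in simp)
        finally show "u (t, x) \<le> \<Phi> (t, x)" by (simp add: \<Phi>_def)
      next
        fix t x assume t: "t \<in> {t0 - r\<^sup>2<..t0}" and x: "x \<in> \<Omega> \<inter> ball x0 r"
        then have xb: "x \<in> \<Omega> \<inter> ball 0 1" using inball by auto
        note bp = barrier_pos[OF xb, of a c]
        obtain Z e where 0: "\<And>b. b \<in> Basis \<Longrightarrow>
            derivs2 (\<lambda>s. barrier a c (x + s *\<^sub>R b)) (barrier a c x * Z b) (e b)"
          "(\<Sum>b\<in>Basis. e b) \<le> barrier a c x *
            (- (1 / (a + c) - 1) * (\<Sum>b\<in>Basis. (Z b)\<^sup>2) - c * \<kappa> / (H * \<rho> x))"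
          by (rule barrier_superharmonic[OF xb a(1,3)]) (rule that)
        have "0 \<le> a + \<gamma>" using a by simp
        obtain Z' e' where 1: "\<And>b. b \<in> Basis \<Longrightarrow>
            derivs2 (\<lambda>s. barrier (a + \<gamma>) c (x + s *\<^sub>R b)) (barrier (a + \<gamma>) c x * Z' b) (e' b)"
          "(\<Sum>b\<in>Basis. e' b) \<le> barrier (a + \<gamma>) c x *
            (- (1 / (a + \<gamma> + c) - 1) * (\<Sum>b\<in>Basis. (Z' b)\<^sup>2) - c * \<kappa> / (H * \<rho> x))"
          by (rule barrier_superharmonic[OF xb \<open>0 \<le> a + \<gamma>\<close> a(3)]) (rule that)
        define f where "f b = 2 / r\<^sup>2 * barrier a c x
            + 2 * (2 * ((x - x0) \<bullet> b) / r\<^sup>2) * (barrier a c x * Z b) + \<eta> t x * e b" for b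
        have "derivs2 (\<lambda>s. \<Phi> (t, x + s *\<^sub>R b))
            (N * K * ((2 * ((x - x0) \<bullet> b) / r\<^sup>2) * barrier a c x + \<eta> t x * (barrier a c x * Z b)
              + B * (barrier (a + \<gamma>) c x * Z' b)))
            (N * K * (f b + B * e' b))" if b: "b \<in> Basis" for b
          using derivs2_cmult[OF derivs2_add[OF
              derivs2_mult[OF derivs2_dist_sq[OF b, of x x0 "t0 - t" r] 0(1)[OF b]]
              derivs2_cmult[OF 1(1)[OF b], of B]], of "N * K"]
          by (simp add: \<Phi>_def \<eta>_def f_def)
        moreover have "((\<lambda>s. \<Phi> (s, x)) has_real_derivative N * K * (- 1 / r\<^sup>2 * barrier a c x)) (at t)"
          unfolding \<Phi>_def \<eta>_def prod.case using R'(3)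
          by (auto intro!: derivative_eq_intros simp: power2_eq_square power4_eq_xxxx)
        moreover have "(\<Sum>b\<in>Basis. N * K * (f b + B * e' b)) < N * K * (- 1 / r\<^sup>2 * barrier a c x)"
        proof -
          let ?S = "\<Sum>b\<in>Basis. (Z b)\<^sup>2" and ?D = "\<Sum>b\<in>Basis. ((x - x0) \<bullet> b) * Z b"
          have \<rho>p: "0 < \<rho> x" by (rule \<rho>[OF xb])
          have "(norm (x - x0))\<^sup>2 / r\<^sup>2 \<le> \<eta> t x"
            using t by (simp add: \<eta>_def divide_right_mono)
          from cut_off_estimate[OF k R'(3) this]
          have cut: "4 / r\<^sup>2 * ?D - \<eta> t x * k * ?S \<le> 4 / (k * r\<^sup>2)" .
          \<comment> \<open>Of the first barrier only the negative square is kept. It comes with the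
            weight \<eta>, just what absorbing the cross term requires.\<close>
          have "(\<Sum>b\<in>Basis. e b) \<le> barrier a c x * (- k * ?S)"
            using 0(2) bp a \<kappa> H \<rho>p
            by (rule_tac order.trans[OF 0(2)]) (auto simp: k_def intro!: mult_left_mono)
          then have "\<eta> t x * (\<Sum>b\<in>Basis. e b) \<le> \<eta> t x * (barrier a c x * (- k * ?S))"
            using \<eta>0[of t x] t by (intro mult_left_mono) auto
          moreover have "(\<Sum>b\<in>Basis. f b) = barrier a c x * (2 * real DIM('a) / r\<^sup>2 + 4 / r\<^sup>2 * ?D)
              + \<eta> t x * (\<Sum>b\<in>Basis. e b)"
          proof -
            have f: "f b = 2 / r\<^sup>2 * barrier a c x + barrier a c x * (4 / r\<^sup>2) * (((x - x0) \<bullet> b) * Z b)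
                + \<eta> t x * e b" for b
              by (simp add: f_def)
            show ?thesis
              unfolding f sum.distrib sum_distrib_left[symmetric] sum_constant
              by (simp add: distrib_left mult_ac)
          qed
          ultimately have "(\<Sum>b\<in>Basis. f b) \<le>
              barrier a c x * (2 * real DIM('a) / r\<^sup>2 + (4 / r\<^sup>2 * ?D - \<eta> t x * k * ?S))"
            by (simp add: algebra_simps)
          also have "\<dots> \<le> barrier a c x * (2 * real DIM('a) / r\<^sup>2 + 4 / (k * r\<^sup>2))"
            using cut bp by (intro mult_left_mono add_left_mono) auto
          finally have f: "(\<Sum>b\<in>Basis. f b) \<le> barrier a c x * (L - 1 / r\<^sup>2)"
            by (simp add: L_def add_divide_distrib algebra_simps)
          have "- (1 / (a + \<gamma> + c) - 1) * (\<Sum>b\<in>Basis. (Z' b)\<^sup>2) \<le> 0"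
            using a by (intro mult_nonpos_nonneg sum_nonneg) auto
          then have S': "- (1 / (a + \<gamma> + c) - 1) * (\<Sum>b\<in>Basis. (Z' b)\<^sup>2) - c * \<kappa> / (H * \<rho> x)
              \<le> - (c * \<kappa> / (H * \<rho> x))" by linarith
          have b1: "barrier (a + \<gamma>) c x = barrier a c x * W x powr \<gamma>"
            by (simp add: barrier_def powr_add)
          have "(\<Sum>b\<in>Basis. e' b) \<le> barrier (a + \<gamma>) c x * (- (c * \<kappa> / (H * \<rho> x)))"
            using order.trans[OF 1(2) mult_left_mono[OF S']] barrier_pos[OF xb, of "a + \<gamma>" c] by simp
          \<comment> \<open>The bound W^\<gamma> \<ge> c2 \<rho> cancels the factor 1/\<rho>, so the
            second barrier yields a fixed negative multiple of the first one, without any factor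
            \<eta>.\<close>
          also have "\<dots> \<le> barrier a c x * (- (c * \<kappa> * c2 / H))"
          proof -
            have "c * \<kappa> / (H * \<rho> x) * (c2 * \<rho> x) \<le> c * \<kappa> / (H * \<rho> x) * W x powr \<gamma>"
              using W\<rho>(2)[OF xb] a \<kappa> H \<rho>p by (intro mult_left_mono) auto
            also have "c * \<kappa> / (H * \<rho> x) * (c2 * \<rho> x) = c * \<kappa> * c2 / H"
              using \<rho>p by simp
            finally have "barrier a c x * (c * \<kappa> * c2 / H) \<le> barrier a c x * (c * \<kappa> / (H * \<rho> x) * W x powr \<gamma>)"
              using bp by (intro mult_left_mono) auto
            then show ?thesis by (simp add: b1 mult_ac)
          qed
          finally have "B * (\<Sum>b\<in>Basis. e' b) \<le> B * (barrier a c x * (- (c * \<kappa> * c2 / H)))"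
            using B by (intro mult_left_mono) auto
          also have "\<dots> = barrier a c x * (- (L + 1))"
            using a \<kappa> W\<rho>(1) H by (simp add: B_def) (simp add: algebra_simps)
          finally have "(\<Sum>b\<in>Basis. f b) + B * (\<Sum>b\<in>Basis. e' b) \<le> barrier a c x * (- 1 / r\<^sup>2 - 1)"
            using f by (simp add: algebra_simps)
          also have "\<dots> < - 1 / r\<^sup>2 * barrier a c x"
            using bp by (simp add: algebra_simps)
          finally have "N * K * ((\<Sum>b\<in>Basis. f b) + B * (\<Sum>b\<in>Basis. e' b)) < N * K * (- 1 / r\<^sup>2 * barrier a c x)"
            using N K by (intro mult_strict_left_mono) auto
          then show ?thesis
            by (simp add: sum.distrib distrib_left sum_distrib_left mult.assoc)
        qed
        ultimately show "\<exists>\<tau> p q. ((\<lambda>s. \<Phi> (s, x)) has_real_derivative \<tau>) (at t) \<and>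
            (\<forall>b\<in>Basis. derivs2 (\<lambda>s. \<Phi> (t, x + s *\<^sub>R b)) (p b) (q b)) \<and> (\<Sum>b\<in>Basis. q b) < \<tau>"
          by (intro exI conjI ballI) assumption+
      qed
      also have "\<dots> = N * K * B * barrier (a + \<gamma>) c x0"
        by (simp add: \<Phi>_def \<eta>_def)
      also have "\<dots> \<le> N * K * B * (H powr c * W x0 powr (a + \<gamma>))"
        using N K B a x0 R by (intro mult_left_mono barrier_le) auto
      finally show ?case by (simp add: mult_ac)
    qed
  qed
qed

lemma heat_bound_0: "heat_bound \<Omega> W 0"
  unfolding heat_bound_def
proof (intro allI impI exI[of _ 1] conjI, goal_cases)
  case (2 R u K t x)
  then have "x \<in> \<Omega> \<inter> ball 0 1" "R\<^sup>2 < 1" by (auto simp: power_less_one_iff)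
  moreover from this have "t \<in> {0<..<1}" using 2 by auto
  ultimately have "u (t, x) \<le> K" using 2 unfolding heat_sol_def by blast
  then show ?case using W_pos[OF \<open>x \<in> \<Omega> \<inter> ball 0 1\<close>] by simp
qed simp

text \<open>One \<open>c\<close> serves all steps, since the condition on the exponents is tightest
  in the last step.\<close>

lemma heat_bound_iterate:
  assumes \<gamma>: "0 < \<gamma>" "0 < c" "real n * \<gamma> + c < 1"
    and W\<rho>: "0 < c2" "\<And>x. x \<in> \<Omega> \<inter> ball 0 1 \<Longrightarrow> c2 * \<rho> x \<le> W x powr \<gamma>"
  shows "heat_bound \<Omega> W (real n * \<gamma>)"
  using \<gamma>(3)
proof (induction n)
  case 0
  then show ?case using heat_bound_0 by simp
next
  case (Suc n)
  then have "heat_bound \<Omega> W (real n * \<gamma>)" using \<gamma> by (simp add: distrib_right)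
  then have "heat_bound \<Omega> W (real n * \<gamma> + \<gamma>)"
    using Suc.prems \<gamma> W\<rho> by (intro heat_bound_step[of _ _ c c2]) (auto simp: distrib_right)
  then show ?case by (simp add: distrib_right add.commute)
qed

end

section \<open>Smooth solutions and the homogeneous harmonic function\<close>

lemma pderiv_dir_slice:
  fixes f :: "real \<times> 'a::euclidean_space \<Rightarrow> real"
  assumes "f differentiable at (t, y)"
  shows "((\<lambda>y. f (t, y)) has_derivative (\<lambda>h. frechet_derivative f (at (t, y)) (0, h))) (at y)"
    and "pderiv_dir b (\<lambda>y. f (t, y)) y = pderiv_dir (0, b) f (t, y)"
proof -
  have D: "(f has_derivative frechet_derivative f (at (t, y))) (at (t, y))"
    using assms by (simp add: frechet_derivative_works)
  show slice: "((\<lambda>y. f (t, y)) has_derivative (\<lambda>h. frechet_derivative f (at (t, y)) (0, h))) (at y)"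
    by (rule has_derivative_compose[of "\<lambda>y. (t, y)", OF _ D]) (auto intro!: derivative_eq_intros)
  show "pderiv_dir b (\<lambda>y. f (t, y)) y = pderiv_dir (0, b) f (t, y)"
    unfolding pderiv_dir_def by (simp flip: frechet_derivative_at[OF slice])
qed

text \<open>\<open>space_laplacian\<close> differentiates the slice at fixed t, smoothness concerns
  space-time. The first derivatives agree on a whole neighbourhood of x in the slice, hence so do
  the second derivatives at x.\<close>

lemma space_laplacian_eq:
  fixes u :: "real \<times> 'a::euclidean_space \<Rightarrow> real"
  assumes u: "smooth_on U u" and U: "open U" "(t, x) \<in> U"
  shows "space_laplacian u (t, x) = (\<Sum>b\<in>Basis. pderiv_dir (0, b) (pderiv_dir (0, b) u) (t, x))"
  unfolding space_laplacian_def laplacian_def fst_conv snd_conv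
proof (rule sum.cong[OF refl])
  fix b :: 'a assume b: "b \<in> Basis"
  have d0: "u differentiable at p" if "p \<in> U" for p
    using u[unfolded smooth_on_def, rule_format, of "[]"] that U
    by (simp add: differentiable_on_eq_differentiable_at)
  have d1: "pderiv_dir (0, b) u differentiable at p" if "p \<in> U" for p
    using u[unfolded smooth_on_def, rule_format, of "[(0, b)]"] b that U
    by (simp add: differentiable_on_eq_differentiable_at zero_prod_def[symmetric] Basis_prod_def)
  have "open (Pair t -` U)"
    using U by (intro open_vimage continuous_intros)
  then have "((pderiv_dir b (\<lambda>y. u (t, y))) has_derivative
      (\<lambda>h. frechet_derivative (pderiv_dir (0, b) u) (at (t, x)) (0, h))) (at x)"
    using pderiv_dir_slice(1)[OF d1[OF U(2)]] U pderiv_dir_slice(2)[OF d0, of t _ b, symmetric]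
    by (elim has_derivative_transform_within_open[rotated]) auto
  then show "pderiv_dir b (pderiv_dir b (\<lambda>y. u (t, y))) x = pderiv_dir (0, b) (pderiv_dir (0, b) u) (t, x)"
    using frechet_derivative_at unfolding pderiv_dir_def[of b "pderiv_dir b _"] pderiv_dir_def[of "(0, b)" "pderiv_dir (0, b) u"]
    by metis
qed

lemma heat_solI:
  fixes u :: "real \<times> 'a::euclidean_space \<Rightarrow> real"
  assumes \<Omega>: "open \<Omega>"
    and u: "smooth_on {(t, x). 0 < t \<and> t < 1 \<and> x \<in> \<Omega> \<inter> ball 0 1} u"
    and cont: "continuous_on (parab_cyl \<Omega> 1) u"
    and eq: "\<And>t x. 0 < t \<Longrightarrow> t < 1 \<Longrightarrow> x \<in> \<Omega> \<inter> ball 0 1 \<Longrightarrow> time_deriv u (t, x) = space_laplacian u (t, x)"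
    and bdry: "\<And>t x. 0 < t \<Longrightarrow> t \<le> 1 \<Longrightarrow> x \<in> frontier \<Omega> \<inter> ball 0 1 \<Longrightarrow>
        (u \<longlongrightarrow> 0) (at (t, x) within parab_cyl \<Omega> 1)"
    and K: "\<And>p. p \<in> parab_cyl \<Omega> 1 \<Longrightarrow> u p \<le> K"
  shows "heat_sol \<Omega> u K"
proof -
  let ?U = "{0<..<1::real} \<times> (\<Omega> \<inter> ball 0 1)"
  have U: "{(t, x). 0 < t \<and> t < 1 \<and> x \<in> \<Omega> \<inter> ball 0 1} = ?U" by auto
  have open_U: "open ?U" using \<Omega> by (intro open_Times) auto
  have sub: "?U \<subseteq> parab_cyl \<Omega> 1" by (auto simp: parab_cyl_def)
  have "\<exists>p q. ((\<lambda>s. u (s, x)) has_real_derivative (\<Sum>b\<in>Basis. q b)) (at t) \<and>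
        (\<forall>b\<in>Basis. derivs2 (\<lambda>s. u (t, x + s *\<^sub>R b)) (p b) (q b))"
    if t: "t \<in> {0<..<1}" and x: "x \<in> \<Omega> \<inter> ball 0 1" for t x
  proof (intro exI conjI ballI)
    have tx: "(t, x) \<in> ?U" using t x by simp
    have time: "(1, 0) \<in> (Basis :: (real \<times> 'a) set)" by (simp add: Basis_prod_def)
    have "((\<lambda>s. u (s + t, x)) has_real_derivative time_deriv u (t, x)) (at 0)"
      using derivs2_deriv[OF derivs2_smooth_line[OF u[unfolded U] open_U tx time]]
      by (simp add: time_deriv_def add.commute)
    then have "((\<lambda>s. u (s, x)) has_real_derivative time_deriv u (t, x)) (at t)"
      using DERIV_shift[of "\<lambda>s. u (s, x)" _ 0 t] by simp
    also have "time_deriv u (t, x) = (\<Sum>b\<in>Basis. pderiv_dir (0, b) (pderiv_dir (0, b) u) (t, x))"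
      using eq[of t x] t x space_laplacian_eq[OF u[unfolded U] open_U tx] by simp
    finally show "((\<lambda>s. u (s, x)) has_real_derivative
        (\<Sum>b\<in>Basis. pderiv_dir (0, b) (pderiv_dir (0, b) u) (t, x))) (at t)" .
    fix b :: 'a assume "b \<in> Basis"
    then have "(0, b) \<in> (Basis :: (real \<times> 'a) set)" by (simp add: Basis_prod_def)
    from derivs2_smooth_line[OF u[unfolded U] open_U tx this]
    show "derivs2 (\<lambda>s. u (t, x + s *\<^sub>R b)) (pderiv_dir (0, b) u (t, x))
        (pderiv_dir (0, b) (pderiv_dir (0, b) u) (t, x))"
      by simp
  qed
  moreover have "(u \<longlongrightarrow> 0) (at (t, x) within ?U)" if "t \<in> {0<..<1}" "x \<in> frontier \<Omega> \<inter> ball 0 1" for t x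
    using tendsto_within_subset[OF bdry sub] that by simp
  ultimately show ?thesis
    unfolding heat_sol_def using continuous_on_subset[OF cont sub] K sub by blast
qed

lemma heat_sol_uminus:
  assumes u: "heat_sol \<Omega> u K" and lower: "\<And>t x. t \<in> {0<..<1} \<Longrightarrow> x \<in> \<Omega> \<inter> ball 0 1 \<Longrightarrow> - K' \<le> u (t, x)"
  shows "heat_sol \<Omega> (\<lambda>p. - u p) K'"
  unfolding heat_sol_def
proof (intro conjI ballI)
  show "continuous_on ({0<..<1} \<times> (\<Omega> \<inter> ball 0 1)) (\<lambda>p. - u p)"
    using u by (auto simp: heat_sol_def intro: continuous_on_minus)
  show "((\<lambda>p. - u p) \<longlongrightarrow> 0) (at (t, x) within {0<..<1} \<times> (\<Omega> \<inter> ball 0 1))"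
    if "t \<in> {0<..<1}" "x \<in> frontier \<Omega> \<inter> ball 0 1" for t x
    using u that tendsto_minus[of u 0] unfolding heat_sol_def by force
  fix t :: real and x assume t: "t \<in> {0<..<1}" and x: "x \<in> \<Omega> \<inter> ball 0 1"
  show "- u (t, x) \<le> K'" using lower[OF t x] by simp
  obtain p q where "((\<lambda>s. u (s, x)) has_real_derivative (\<Sum>b\<in>Basis. q b)) (at t)"
      "\<forall>b\<in>Basis. derivs2 (\<lambda>s. u (t, x + s *\<^sub>R b)) (p b) (q b)"
    using u t x unfolding heat_sol_def by blast
  then show "\<exists>p q. ((\<lambda>s. - u (s, x)) has_real_derivative (\<Sum>b\<in>Basis. q b)) (at t) \<and>
        (\<forall>b\<in>Basis. derivs2 (\<lambda>s. - u (t, x + s *\<^sub>R b)) (p b) (q b))"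
    by (intro exI[of _ "\<lambda>b. - p b"] exI[of _ "\<lambda>b. - q b"])
      (auto simp: sum_negf intro: DERIV_minus derivs2_uminus)
qed

section \<open>Cones, extensions of degree 0 and the harmonicity of \<open>W0\<close>\<close>

lemma open_cone_of:
  assumes "openin (top_of_set (sphere 0 1)) M"
  shows "open (cone_of M)"
proof -
  obtain T where T: "open T" "M = sphere 0 1 \<inter> T"
    using assms by (auto simp: openin_open)
  have "open (- {0} \<inter> (\<lambda>x. x /\<^sub>R norm x) -` T)"
    using T(1) by (intro continuous_open_preimage continuous_intros) auto
  also have "- {0} \<inter> (\<lambda>x. x /\<^sub>R norm x) -` T = cone_of M"
    by (auto simp: cone_of_def T(2))
  finally show ?thesis .
qed

lemma radial_ext_scale: "0 < c \<Longrightarrow> radial_ext f (c *\<^sub>R y) = radial_ext f y"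
proof -
  assume "0 < c"
  then have "(c *\<^sub>R y) /\<^sub>R norm (c *\<^sub>R y) = y /\<^sub>R norm y" by (cases "y = 0") (auto simp: field_simps)
  then show ?thesis by (simp only: radial_ext_def)
qed

text \<open>Euler's relation in degree 0: the function is constant on the ray through \<sigma>, so
  its derivative in the direction \<sigma> vanishes.\<close>

lemma radial_ext_euler:
  fixes \<sigma> :: "'a::euclidean_space"
  assumes "radial_ext f differentiable at \<sigma>"
  shows "(\<Sum>b\<in>Basis. (\<sigma> \<bullet> b) * pderiv_dir b (radial_ext f) \<sigma>) = 0"
proof -
  let ?F = "radial_ext f" and ?D = "frechet_derivative (radial_ext f) (at \<sigma>)"
  have D: "(?F has_derivative ?D) (at (\<sigma> + 0 *\<^sub>R \<sigma>))"
    using assms by (simp add: frechet_derivative_works)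
  have lin: "linear ?D" using has_derivative_linear[OF D] .
  have "((\<lambda>s. ?F (\<sigma> + s *\<^sub>R \<sigma>)) has_derivative (\<lambda>h. ?D (h *\<^sub>R \<sigma>))) (at 0)"
    by (rule has_derivative_compose[of "\<lambda>s. \<sigma> + s *\<^sub>R \<sigma>", OF _ D]) (auto intro!: derivative_eq_intros)
  then have "((\<lambda>s. ?F (\<sigma> + s *\<^sub>R \<sigma>)) has_real_derivative ?D \<sigma>) (at 0)"
    using linear_scale[OF lin] by (simp add: has_field_derivative_def mult.commute[of _ "?D \<sigma>"])
  moreover have "?F (\<sigma> + s *\<^sub>R \<sigma>) = ?F \<sigma>" if "\<bar>s\<bar> < 1" for s
  proof -
    have "\<sigma> + s *\<^sub>R \<sigma> = (1 + s) *\<^sub>R \<sigma>" by (simp add: scaleR_left_distrib)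
    then show ?thesis using that radial_ext_scale[of "1 + s" f \<sigma>] by simp
  qed
  ultimately have "?D \<sigma> = 0"
    using DERIV_local_const[of "\<lambda>s. ?F (\<sigma> + s *\<^sub>R \<sigma>)" "?D \<sigma>" 0 1] by simp
  moreover have "?D \<sigma> = ?D (\<Sum>b\<in>Basis. (\<sigma> \<bullet> b) *\<^sub>R b)" by (simp add: euclidean_representation)
  moreover have "\<dots> = (\<Sum>b\<in>Basis. (\<sigma> \<bullet> b) * ?D b)"
    using lin by (simp add: linear_sum linear_scale)
  ultimately show ?thesis by (simp add: pderiv_dir_def)
qed

text \<open>All quotients are nonnegative, but a lower bound for the infimum also requires a
  nonempty index set. If every test function vanished on M, then \<open>w\<close>, a limit of test
  functions in the L2 norm, could not have norm 1.\<close>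

lemma Lambda0_nonneg:
  fixes w :: "'a::euclidean_space \<Rightarrow> real"
  assumes w: "first_dirichlet_eigenfunction M w"
  shows "0 \<le> Lambda0 M"
proof -
  have "\<exists>\<phi>. sph_test_fun M \<phi> \<and> (\<exists>\<sigma>\<in>M. \<phi> \<sigma> \<noteq> 0)"
  proof (rule ccontr)
    assume none: "\<not> ?thesis"
    obtain \<phi> where \<phi>: "\<And>n. sph_test_fun M (\<phi> n)"
      and lim: "(\<lambda>n. sph_L2norm M (\<lambda>\<sigma>. w \<sigma> - \<phi> n \<sigma>)
             + sph_L2norm M (\<lambda>\<sigma>. norm (sph_grad w \<sigma> - sph_grad (\<phi> n) \<sigma>))) \<longlonglongrightarrow> 0"
      using w unfolding first_dirichlet_eigenfunction_def in_W12_0_def by blast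
    have "sph_L2norm M (\<lambda>\<sigma>. w \<sigma> - \<phi> n \<sigma>) = sph_L2norm M w" for n
    proof -
      have "indicator M \<sigma> *\<^sub>R (w \<sigma> - \<phi> n \<sigma>)\<^sup>2 = indicator M \<sigma> *\<^sub>R (w \<sigma>)\<^sup>2" for \<sigma>
        using none \<phi>[of n] by (cases "\<sigma> \<in> M") auto
      then show ?thesis by (simp only: sph_L2norm_def set_lebesgue_integral_def)
    qed
    also have "sph_L2norm M w = 1"
      using w by (simp add: sph_L2norm_def first_dirichlet_eigenfunction_def)
    finally have "1 \<le> sph_L2norm M (\<lambda>\<sigma>. w \<sigma> - \<phi> n \<sigma>)
             + sph_L2norm M (\<lambda>\<sigma>. norm (sph_grad w \<sigma> - sph_grad (\<phi> n) \<sigma>))" for n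
      by (simp add: sph_L2norm_def set_lebesgue_integral_def)
    then show False
      using LIMSEQ_le_const[OF lim, of 1] by auto
  qed
  then show ?thesis
    unfolding Lambda0_def
    by (intro cINF_greatest) (auto simp: set_lebesgue_integral_def intro!: divide_nonneg_nonneg)
qed

text \<open>\<open>lambda0 M\<close> is the larger root of this quadratic equation; the hypothesis
  keeps the radicand nonnegative.\<close>

lemma lambda0_eq:
  fixes M :: "'a::euclidean_space set"
  assumes "0 \<le> Lambda0 M"
  shows "lambda0 M * (lambda0 M + real DIM('a) - 2) = Lambda0 M"
proof -
  define m where "m = (real DIM('a) - 2) / 2"
  define s where "s = sqrt (Lambda0 M + m\<^sup>2)"
  have s: "s\<^sup>2 = Lambda0 M + m\<^sup>2" using assms by (simp add: s_def)
  have l: "lambda0 M = - m + s"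
    by (simp only: lambda0_def m_def s_def minus_divide_left)
  moreover have "real DIM('a) = 2 * m + 2" by (simp add: m_def field_simps)
  ultimately have "lambda0 M + real DIM('a) - 2 = m + s" by simp
  then have "lambda0 M * (lambda0 M + real DIM('a) - 2) = s\<^sup>2 - m\<^sup>2"
    unfolding l by (simp add: power2_eq_square algebra_simps)
  then show ?thesis using s by simp
qed

lemma W0_eq: "W0 M w x = norm x powr lambda0 M * radial_ext w x"
  by (simp add: W0_def radial_ext_def)

text \<open>For |x|^\<lambda> F(x) with F of degree 0, the cross terms of the product rule sum to 0
  by Euler's relation. The rest is (\<lambda> (\<lambda> + d - 2) - \<open>Lambda0 M\<close>)
  |x|^(\<lambda> - 2) F(x), which is 0 by the choice of \<lambda>.\<close>

lemma W0_harmonic: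
  fixes x :: "'a::euclidean_space"
  assumes w: "first_dirichlet_eigenfunction M w" and \<Omega>: "open (cone_of M)" and x: "x \<in> cone_of M"
  shows "\<exists>p q. (\<forall>b\<in>Basis. derivs2 (\<lambda>s. W0 M w (x + s *\<^sub>R b)) (p b) (q b)) \<and> (\<Sum>b\<in>Basis. q b) = 0"
proof -
  define \<sigma> where "\<sigma> = x /\<^sub>R norm x"
  define n where "n = norm x"
  define l where "l = lambda0 M"
  define F where "F = radial_ext w"
  define P where "P b = pderiv_dir b F \<sigma>" for b
  define Q where "Q b = pderiv_dir b (pderiv_dir b F) \<sigma>" for b
  have n: "0 < n" and \<sigma>: "\<sigma> \<in> M" and x\<sigma>: "x = n *\<^sub>R \<sigma>"
    using x by (auto simp: cone_of_def n_def \<sigma>_def)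
  have \<sigma>1: "norm \<sigma> = 1" using n by (simp add: \<sigma>_def n_def)
  then have \<sigma>\<Omega>: "\<sigma> \<in> cone_of M" using \<sigma> by (auto simp: cone_of_def)
  have smooth: "smooth_on (cone_of M) F"
    using w by (simp add: first_dirichlet_eigenfunction_def sph_smooth_def F_def)
  \<comment> \<open>The eigenvalue equation is given only on the sphere; degree 0 moves it from
    \<sigma> to x = n \<sigma>, scaling first derivatives by 1/n and second ones by 1/n^2.\<close>
  have F: "derivs2 (\<lambda>s. F (x + s *\<^sub>R b)) (1 / n * P b) ((1 / n)\<^sup>2 * Q b)" if b: "b \<in> Basis" for b
  proof -
    have "F (\<sigma> + (1 / n * s) *\<^sub>R b) = F (x + s *\<^sub>R b)" for s
    proof -
      have "\<sigma> + (1 / n * s) *\<^sub>R b = (1 / n) *\<^sub>R (x + s *\<^sub>R b)"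
        using n by (simp add: x\<sigma> scaleR_right_distrib)
      then show ?thesis using radial_ext_scale[of "1 / n" w "x + s *\<^sub>R b"] n by (simp add: F_def)
    qed
    with derivs2_rescale[OF derivs2_smooth_line[OF smooth \<Omega> \<sigma>\<Omega> b], of "1 / n"]
    show ?thesis by (simp add: P_def Q_def)
  qed
  define q where "q b = (l * (l - 2) * n powr (l - 4) * (x \<bullet> b)\<^sup>2 + l * n powr (l - 2)) * F x
      + 2 * (l * n powr (l - 2) * (x \<bullet> b)) * (1 / n * P b) + n powr l * ((1 / n)\<^sup>2 * Q b)" for b
  have "derivs2 (\<lambda>s. W0 M w (x + s *\<^sub>R b))
      (l * n powr (l - 2) * (x \<bullet> b) * F x + n powr l * (1 / n * P b)) (q b)" if b: "b \<in> Basis" for b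
  proof -
    have "norm b = 1" "x \<noteq> 0" using b n by (auto simp: n_def)
    from derivs2_mult[OF derivs2_norm_powr_line[OF this, of l] F[OF b]]
    show ?thesis by (simp add: W0_eq l_def[symmetric] F_def[symmetric] n_def[symmetric] q_def)
  qed
  moreover have "(\<Sum>b\<in>Basis. q b) = 0"
  proof -
    have "F differentiable at \<sigma>"
      using smooth[unfolded smooth_on_def, rule_format, of "[]"] \<Omega> \<sigma>\<Omega>
      by (simp add: differentiable_on_eq_differentiable_at)
    then have "(\<Sum>b\<in>Basis. (\<sigma> \<bullet> b) * P b) = 0"
      unfolding F_def P_def by (rule radial_ext_euler)
    then have euler: "(\<Sum>b\<in>Basis. (x \<bullet> b) * P b) = 0"
      unfolding x\<sigma> inner_scaleR_left mult.assoc sum_distrib_left[symmetric] by simp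
    have lap: "(\<Sum>b\<in>Basis. Q b) = - Lambda0 M * F x"
    proof -
      have "sph_laplacian w \<sigma> + Lambda0 M * w \<sigma> = 0"
        using w \<sigma> by (simp add: first_dirichlet_eigenfunction_def)
      moreover have "sph_laplacian w \<sigma> = (\<Sum>b\<in>Basis. Q b)"
        by (simp only: sph_laplacian_def laplacian_def Q_def F_def)
      moreover have "F x = w \<sigma>"
        by (simp only: F_def radial_ext_def \<sigma>_def)
      ultimately show ?thesis by simp
    qed
    have "q b = (l * (l - 2) * n powr (l - 4) * (x \<bullet> b)\<^sup>2 + l * n powr (l - 2)) * F x
      + 2 * l * n powr (l - 2) / n * ((x \<bullet> b) * P b) + n powr (l - 2) * Q b" for b
      using n by (simp add: q_def powr_diff power2_eq_square field_simps)
    then have q: "q = (\<lambda>b. (l * (l - 2) * n powr (l - 4) * (x \<bullet> b)\<^sup>2 + l * n powr (l - 2)) * F x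
      + 2 * l * n powr (l - 2) / n * ((x \<bullet> b) * P b) + n powr (l - 2) * Q b)" by blast
    have "x \<noteq> 0" using n by (simp add: n_def)
    have "(\<Sum>b\<in>Basis. q b) = l * (l + real DIM('a) - 2) * n powr (l - 2) * F x
        + 2 * l * n powr (l - 2) / n * (\<Sum>b\<in>Basis. (x \<bullet> b) * P b) + n powr (l - 2) * (\<Sum>b\<in>Basis. Q b)"
      unfolding q sum.distrib[of "\<lambda>b. _ b + _ b"] sum.distrib[of "\<lambda>b. _ b * F x"]
        sum_distrib_left[symmetric] sum_distrib_right[symmetric] n_def laplacian_norm_powr[OF \<open>x \<noteq> 0\<close>] ..
    also have "\<dots> = 0"
      unfolding euler lap lambda0_eq[OF Lambda0_nonneg[OF w], folded l_def] by simp
    finally show ?thesis .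
  qed
  ultimately show ?thesis by (intro exI conjI ballI)
qed

lemma W0_continuous:
  assumes w: "first_dirichlet_eigenfunction M w"
  shows "continuous_on (cone_of M) (W0 M w)"
proof -
  have "radial_ext w differentiable_on cone_of M"
    using w unfolding first_dirichlet_eigenfunction_def sph_smooth_def smooth_on_def
    by (metis empty_set empty_subsetI iter_pderiv.simps(1))
  then have "continuous_on (cone_of M) (\<lambda>x. norm x powr lambda0 M * radial_ext w x)"
    by (intro continuous_intros differentiable_imp_continuous_on) (auto simp: cone_of_def)
  then show ?thesis by (simp add: W0_eq[abs_def])
qed

lemma W0_pos:
  assumes "first_dirichlet_eigenfunction M w" "x \<in> cone_of M"
  shows "0 < W0 M w x"
  using assms by (auto simp: first_dirichlet_eigenfunction_def cone_of_def W0_def)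

section \<open>Conic domains\<close>

lemma isCont_riesz_potential:
  fixes x :: "'a::euclidean_space"
  assumes E: "E \<in> sets lborel" "emeasure lborel E < \<infinity>"
    and dist: "\<delta> > 0" "\<And>y. y \<in> E \<Longrightarrow> \<delta> \<le> norm (x - y)" and p: "p \<le> 0"
  shows "isCont (\<lambda>x. \<integral>y. norm (x - y) powr p \<partial>restrict_space lborel E) x"
proof -
  let ?M = "restrict_space lborel E"
  interpret finite_measure ?M
    using E by (intro finite_measureI) (auto simp: emeasure_restrict_space space_restrict_space)
  have meas: "(\<lambda>y. norm (z - y) powr p) \<in> borel_measurable ?M" for z
    by (intro measurable_restrict_space1) simp
  have "((\<lambda>x. \<integral>y. norm (x - y) powr p \<partial>?M) \<longlongrightarrow> (\<integral>y. norm (x - y) powr p \<partial>?M))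
      (at x within ball x (\<delta> / 2))"
    unfolding tendsto_at_iff_sequentially o_def
  proof (intro allI impI)
    fix X :: "nat \<Rightarrow> 'a" assume X: "\<forall>i. X i \<in> ball x (\<delta> / 2) - {x}" "X \<longlonglongrightarrow> x"
    show "(\<lambda>i. \<integral>y. norm (X i - y) powr p \<partial>?M) \<longlonglongrightarrow> (\<integral>y. norm (x - y) powr p \<partial>?M)"
    proof (rule integral_dominated_convergence[where w = "\<lambda>_. (\<delta> / 2) powr p"])
      show "AE y in ?M. (\<lambda>i. norm (X i - y) powr p) \<longlonglongrightarrow> norm (x - y) powr p"
      proof (rule AE_I2)
        fix y assume "y \<in> space ?M"
        then have "x - y \<noteq> 0" using dist(1) dist(2)[of y] by (auto simp: space_restrict_space)
        then show "(\<lambda>i. norm (X i - y) powr p) \<longlonglongrightarrow> norm (x - y) powr p"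
          using X(2) by (intro tendsto_powr tendsto_norm tendsto_diff tendsto_const) auto
      qed
      show "AE y in ?M. norm (norm (X i - y) powr p) \<le> (\<delta> / 2) powr p" for i
      proof (rule AE_I2)
        fix y assume "y \<in> space ?M"
        then have "\<delta> \<le> norm (x - y)" using dist(2)[of y] by (auto simp: space_restrict_space)
        moreover have "norm (x - X i) < \<delta> / 2" using X(1)[rule_format, of i] by (simp add: dist_norm)
        moreover have "norm (x - y) \<le> norm (x - X i) + norm (X i - y)"
          using norm_triangle_ineq[of "x - X i" "X i - y"] by simp
        ultimately have "\<delta> / 2 \<le> norm (X i - y)" by linarith
        then show "norm (norm (X i - y) powr p) \<le> (\<delta> / 2) powr p"
          using dist(1) p by (simp add: powr_mono2')
      qed
    qed (use meas in auto)
  qed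
  then show ?thesis
    using dist(1) by (simp add: isCont_def at_within_open[of x "ball x (\<delta> / 2)"])
qed

text \<open>A nonempty boundary is assumed because \<open>infdist\<close> to the empty set is 0 by
  convention; for the theorem it follows from the connectedness of the sphere.\<close>

locale conic_domain =
  fixes M :: "'a::euclidean_space set"
  assumes dim: "DIM('a) \<ge> 2"
    and M_sub: "M \<subseteq> sphere 0 1"
    and M_open: "openin (top_of_set (sphere 0 1)) M"
    and boundary_nonempty: "closure M - M \<noteq> {}"
    and M_density: "\<exists>c>0. \<forall>p\<in>closure M - M. \<forall>r\<in>{0<..1::real}.
        c \<le> measure sphere_measure {\<sigma>\<in>sphere 0 1 - M. dist \<sigma> p < r} / r ^ (DIM('a) - 1)"
begin

text \<open>A substitute, homogeneous of degree 1, for the distance to the boundary of the cone.\<close>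
definition bdist :: "'a \<Rightarrow> real" where
  "bdist x = norm x * infdist (x /\<^sub>R norm x) (closure M - M)"

lemma closed_boundary: "closed (closure M - M)"
proof -
  obtain T where T: "open T" "M = sphere 0 1 \<inter> T"
    using M_open by (auto simp: openin_open)
  have "closure M \<subseteq> sphere 0 1" using M_sub by (rule closure_minimal) simp
  then have "closure M - M = closure M \<inter> - T" using T(2) by auto
  then show ?thesis using T(1) by (simp add: closed_Int closed_Compl)
qed

lemma boundary_sphere: "closure M - M \<subseteq> sphere 0 1"
  using closure_minimal[OF M_sub closed_sphere] by auto

lemma infdist_boundary:
  assumes "\<sigma> \<in> M"
  obtains p where "p \<in> closure M - M" "infdist \<sigma> (closure M - M) = dist \<sigma> p" "0 < dist \<sigma> p" "dist \<sigma> p \<le> 2"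
proof -
  obtain p where p: "p \<in> closure M - M" "infdist \<sigma> (closure M - M) = dist \<sigma> p"
    using infdist_attains_inf[OF closed_boundary boundary_nonempty] by blast
  have "norm \<sigma> = 1" "norm p = 1" using assms M_sub p boundary_sphere by auto
  then have "dist \<sigma> p \<le> 2" using norm_triangle_ineq4[of \<sigma> p] by (simp add: dist_norm)
  moreover have "\<sigma> \<noteq> p" using p assms by auto
  ultimately show ?thesis using that p by auto
qed

lemma bdist_bounds:
  assumes "x \<in> cone_of M \<inter> ball 0 1"
  shows "0 < bdist x" "bdist x < 2"
proof -
  have x: "x /\<^sub>R norm x \<in> M" "0 < norm x" "norm x < 1" using assms by (auto simp: cone_of_def)
  obtain p where "infdist (x /\<^sub>R norm x) (closure M - M) = dist (x /\<^sub>R norm x) p"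
      "0 < dist (x /\<^sub>R norm x) p" "dist (x /\<^sub>R norm x) p \<le> 2"
    using infdist_boundary[OF x(1)] by metis
  then have d: "0 < infdist (x /\<^sub>R norm x) (closure M - M)" "infdist (x /\<^sub>R norm x) (closure M - M) \<le> 2"
    by auto
  show "0 < bdist x" using d x by (simp add: bdist_def)
  have "bdist x \<le> norm x * 2" using d x unfolding bdist_def by (intro mult_left_mono) auto
  then show "bdist x < 2" using x by simp
qed

definition ext :: "'a set" where "ext = ball 0 1 - cone_of M"

lemma ext: "ext \<in> sets lborel" "ext \<subseteq> ball 0 1" "emeasure lborel ext < \<infinity>"
proof -
  have "open (cone_of M)" using M_open by (rule open_cone_of)
  then show 1: "ext \<in> sets lborel" unfolding ext_def by simp
  show 2: "ext \<subseteq> ball 0 1" by (auto simp: ext_def)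
  then show "emeasure lborel ext < \<infinity>"
    using emeasure_mono[of ext "ball 0 1" lborel] emeasure_lborel_ball_finite[of "0::'a" 1]
    by (auto intro: order_le_less_trans)
qed

lemma ext_distance:
  assumes "x \<in> cone_of M"
  obtains \<delta> where "\<delta> > 0" "\<And>y. y \<in> ext \<Longrightarrow> \<delta> \<le> norm (x - y)"
proof -
  obtain \<delta> where "\<delta> > 0" "ball x \<delta> \<subseteq> cone_of M"
    using open_cone_of[OF M_open] assms open_contains_ball by blast
  then show ?thesis
    by (intro that[of \<delta>]) (auto simp: ext_def dist_norm not_less[symmetric])
qed

text \<open>Near the boundary point p closest to \<sigma> = x / |x| the density hypothesis supplies
  a set G0 of directions outside M. A shell over G0 lies in \<open>ext\<close>, has volume at least
  a multiple of \<rho>^d and lies within 2 \<rho> of x, where the kernel is at least (2 \<rho>)^(-d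
  - 1).\<close>

lemma riesz_ext_lower:
  obtains \<kappa> where "0 < \<kappa>" "\<And>x. x \<in> cone_of M \<inter> ball 0 1 \<Longrightarrow>
    \<kappa> / bdist x \<le> (\<integral>y. norm (x - y) powr (- real DIM('a) - 1) \<partial>restrict_space lborel ext)"
proof -
  let ?d = "DIM('a)"
  obtain c where c: "0 < c" "\<And>p r. p \<in> closure M - M \<Longrightarrow> 0 < r \<Longrightarrow> r \<le> 1 \<Longrightarrow>
      c \<le> measure sphere_measure {\<sigma>\<in>sphere 0 1 - M. dist \<sigma> p < r} / r ^ (?d - 1)"
    using M_density by force
  obtain T where T: "open T" "M = sphere 0 1 \<inter> T"
    using M_open by (auto simp: openin_open)
  then have M_borel: "M \<in> sets borel" by simp
  \<comment> \<open>The factor c / d turns surface measure into volume, (1/2)^d comes from r being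
    half the distance to p, and the last factor from the distance bound 2 \<rho>.\<close>
  define \<kappa> where "\<kappa> = c / real ?d * (1 / 2) ^ ?d * 2 powr (- real ?d - 1)"
  show ?thesis
  proof (rule that)
    show "0 < \<kappa>" using c dim by (simp add: \<kappa>_def)
    fix x assume x: "x \<in> cone_of M \<inter> ball 0 1"
    define n where "n = norm x"
    define \<sigma> where "\<sigma> = x /\<^sub>R norm x"
    have n: "0 < n" "n < 1" and \<sigma>: "\<sigma> \<in> M" and x\<sigma>: "x = n *\<^sub>R \<sigma>"
      using x by (auto simp: cone_of_def n_def \<sigma>_def)
    obtain p where p: "p \<in> closure M - M" "infdist \<sigma> (closure M - M) = dist \<sigma> p"
        "0 < dist \<sigma> p" "dist \<sigma> p \<le> 2"
      using infdist_boundary[OF \<sigma>] by blast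
    define \<rho> where "\<rho> = bdist x"
    have \<rho>: "\<rho> = n * dist \<sigma> p" "0 < \<rho>"
      using p n by (auto simp: \<rho>_def bdist_def n_def \<sigma>_def)
    \<comment> \<open>Halving makes r \<le> 1, as the density hypothesis demands, because chords of
      the sphere have length at most 2.\<close>
    define r where "r = dist \<sigma> p / 2"
    have r: "0 < r" "r \<le> 1" using p by (auto simp: r_def)
    define G0 where "G0 = {\<tau>\<in>sphere 0 1 - M. dist \<tau> p < r}"
    have "G0 = (sphere 0 1 - M) \<inter> ball p r"
      by (auto simp: G0_def dist_commute)
    then have G0: "G0 \<in> sets borel" "G0 \<subseteq> sphere 0 1"
      using M_borel by (auto simp: G0_def)
    \<comment> \<open>The shell lies below the radius n < 1, so \<open>G\<close> stays inside the
      unit ball.\<close>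
    define G where "G = sector G0 n - sector G0 ((1 - r) * n)"
    have "c * r ^ (?d - 1) \<le> measure sphere_measure G0"
      using c(2)[OF p(1) r] r by (simp add: G0_def pos_le_divide_eq)
    then have "c * r ^ (?d - 1) / real ?d * r * n ^ ?d \<le> measure sphere_measure G0 / real ?d * r * n ^ ?d"
      using r n by (intro mult_right_mono divide_right_mono) auto
    also have "\<dots> \<le> measure lborel G"
      unfolding G_def by (rule measure_sector_shell[OF G0 n(1) r])
    also have "c * r ^ (?d - 1) / real ?d * r * n ^ ?d = c / real ?d * (1 / 2) ^ ?d * \<rho> ^ ?d"
    proof -
      have "r ^ (?d - 1) * r = r ^ ?d" using dim by (simp flip: power_Suc2)
      moreover have "r * n = 1 / 2 * \<rho>" by (simp add: r_def \<rho>)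
      then have "r ^ ?d * n ^ ?d = (1 / 2) ^ ?d * \<rho> ^ ?d" by (simp only: power_mult_distrib[symmetric])
      ultimately show ?thesis by (simp add: mult_ac)
    qed
    finally have mG: "c / real ?d * (1 / 2) ^ ?d * \<rho> ^ ?d \<le> measure lborel G" .
    have G_sub: "G \<subseteq> ext"
      using n by (auto simp: G_def ext_def sector_def cone_of_def G0_def)
    have G_near: "norm (x - y) \<le> 2 * \<rho>" if "y \<in> G" for y
    proof -
      define m where "m = norm y"
      define \<tau> where "\<tau> = y /\<^sub>R norm y"
      have m: "0 < m" "m < n" "(1 - r) * n \<le> m" and \<tau>: "\<tau> \<in> G0" and y: "y = m *\<^sub>R \<tau>"
        using that by (auto simp: G_def sector_def m_def \<tau>_def not_less)
      have "norm \<tau> = 1" "norm (p - \<tau>) < r" using \<tau> by (auto simp: G0_def dist_norm norm_minus_commute)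
      \<comment> \<open>Path from x to n p, then to n \<tau>, then radially to y = m \<tau>; the
        lengths are \<rho>, at most \<rho> / 2 and at most \<rho> / 2.\<close>
      have "x - y = n *\<^sub>R (\<sigma> - p) + n *\<^sub>R (p - \<tau>) + (n - m) *\<^sub>R \<tau>"
        by (simp add: x\<sigma> y algebra_simps)
      then have "norm (x - y) \<le> n * dist \<sigma> p + n * norm (p - \<tau>) + (n - m) * norm \<tau>"
        using n m norm_triangle_ineq[of "n *\<^sub>R (\<sigma> - p) + n *\<^sub>R (p - \<tau>)" "(n - m) *\<^sub>R \<tau>"]
          norm_triangle_ineq[of "n *\<^sub>R (\<sigma> - p)" "n *\<^sub>R (p - \<tau>)"]
        by (simp add: dist_norm)
      also have "n * norm (p - \<tau>) \<le> n * r"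
        using n \<open>norm (p - \<tau>) < r\<close> by (intro mult_left_mono) auto
      also have "(n - m) * norm \<tau> \<le> n * r"
        using m \<open>norm \<tau> = 1\<close> by (simp add: algebra_simps)
      finally show ?thesis by (simp add: \<rho> r_def)
    qed
    obtain \<delta> where \<delta>: "\<delta> > 0" "\<And>y. y \<in> ext \<Longrightarrow> \<delta> \<le> norm (x - y)"
      using ext_distance x by blast
    have "\<kappa> / \<rho> = c / real ?d * (1 / 2) ^ ?d * \<rho> ^ ?d * (2 * \<rho>) powr (- real ?d - 1)"
      using \<rho>(2) by (simp add: \<kappa>_def powr_mult powr_diff powr_minus powr_realpow field_simps)
    also have "\<dots> \<le> measure lborel G * (2 * \<rho>) powr (- real ?d - 1)"
      using mG by (intro mult_right_mono) auto
    also have "\<dots> \<le> (\<integral>y. norm (x - y) powr (- real ?d - 1) \<partial>restrict_space lborel ext)"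
      using G_sub G_near sets_sector[OF G0(1)]
      by (intro riesz_potential_lower[OF ext(1,3) \<delta>]) (auto simp: G_def)
    finally show "\<kappa> / bdist x \<le> (\<integral>y. norm (x - y) powr (- real ?d - 1) \<partial>restrict_space lborel ext)"
      by (simp add: \<rho>_def)
  qed
qed

lemma strict_superharmonic:
  obtains h :: "'a \<Rightarrow> real" and H \<kappa> where "0 < \<kappa>" "continuous_on (cone_of M \<inter> ball 0 1) h"
    "\<And>x. x \<in> cone_of M \<inter> ball 0 1 \<Longrightarrow> 1 \<le> h x \<and> h x \<le> H"
    "\<And>x. x \<in> cone_of M \<inter> ball 0 1 \<Longrightarrow> \<exists>p q.
        (\<forall>b\<in>Basis. derivs2 (\<lambda>s. h (x + s *\<^sub>R b)) (p b) (q b)) \<and> (\<Sum>b\<in>Basis. q b) \<le> - (\<kappa> / bdist x)"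
proof -
  define q where "q = real DIM('a) - 1"
  define S where "S x = (\<integral>y. norm (x - y) powr (- q) \<partial>restrict_space lborel ext)" for x
  define C where "C = 2 ^ (DIM('a) + 1) * unit_ball_vol (real DIM('a))"
  \<comment> \<open>As 0 \<le> S \<le> C on the unit ball, h lies between 1 and C + 1. The sign
    turns the positive Laplacian of S, with coefficient q (q + 2 - d) = q, into a negative
    one.\<close>
  define h where "h x = (C + 1) + - S x" for x
  have q: "1 \<le> q" using dim by (simp add: q_def)
  obtain \<kappa> where \<kappa>: "0 < \<kappa>" "\<And>x. x \<in> cone_of M \<inter> ball 0 1 \<Longrightarrow>
    \<kappa> / bdist x \<le> (\<integral>y. norm (x - y) powr (- real DIM('a) - 1) \<partial>restrict_space lborel ext)"
    using riesz_ext_lower by blast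
  show ?thesis
  proof (rule that)
    show "0 < q * \<kappa>" using q \<kappa> by simp
    have "isCont S x" if x: "x \<in> cone_of M" for x
    proof -
      obtain \<delta> where "\<delta> > 0" "\<And>y. y \<in> ext \<Longrightarrow> \<delta> \<le> norm (x - y)" using ext_distance x by blast
      then show ?thesis
        unfolding S_def[abs_def] using q by (intro isCont_riesz_potential ext) auto
    qed
    then show "continuous_on (cone_of M \<inter> ball 0 1) h"
      unfolding h_def[abs_def]
      by (intro continuous_on_add continuous_on_const continuous_on_minus continuous_at_imp_continuous_on) auto
  next
    fix x assume x: "x \<in> cone_of M \<inter> ball 0 1"
    have "0 \<le> S x" by (simp add: S_def)
    moreover have "S x \<le> C"
      using x riesz_potential_bounded[OF ext(1,2), of x] by (simp add: S_def C_def q_def)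
    ultimately show "1 \<le> h x \<and> h x \<le> C + 1" by (simp add: h_def)
    obtain \<delta> where \<delta>: "\<delta> > 0" "\<And>y. y \<in> ext \<Longrightarrow> \<delta> \<le> norm (x - y)"
      using ext_distance x by blast
    define d2 where "d2 b = (\<integral>y. - q * (- q - 2) * norm (x - y) powr (- q - 4) * ((x - y) \<bullet> b)\<^sup>2 +
         - q * norm (x - y) powr (- q - 2) \<partial>restrict_space lborel ext)" for b
    define d1 where "d1 b = (\<integral>y. - q * norm (x - y) powr (- q - 2) * ((x - y) \<bullet> b) \<partial>restrict_space lborel ext)" for b
    have q0: "0 \<le> q" using q by simp
    have "derivs2 (\<lambda>s. h (x + s *\<^sub>R b)) (0 + - d1 b) (0 + - d2 b)" if b: "b \<in> Basis" for b
    proof -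
      have "norm b = 1" using b by simp
      from derivs2_riesz_potential(1)[OF ext(1,3) \<delta> this q0]
      have "derivs2 (\<lambda>s. S (x + s *\<^sub>R b)) (d1 b) (d2 b)"
        unfolding S_def d1_def d2_def .
      then show ?thesis
        unfolding h_def by (intro derivs2_add derivs2_const derivs2_uminus)
    qed
    moreover have "(\<Sum>b\<in>Basis. 0 + - d2 b) \<le> - (q * \<kappa> / bdist x)"
    proof -
      have "(\<Sum>b\<in>Basis. d2 b) = q * (q + 2 - real DIM('a)) *
          (\<integral>y. norm (x - y) powr (- q - 2) \<partial>restrict_space lborel ext)"
        unfolding d2_def by (rule laplacian_riesz_potential[OF ext(1,3) \<delta> q0])
      also have "q + 2 - real DIM('a) = 1" by (simp add: q_def)
      also have "- q - 2 = - real DIM('a) - 1" by (simp add: q_def)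
      finally show ?thesis
        using mult_left_mono[OF \<kappa>(2)[OF x] q0] by (simp add: sum_negf)
    qed
    ultimately show "\<exists>p q'. (\<forall>b\<in>Basis. derivs2 (\<lambda>s. h (x + s *\<^sub>R b)) (p b) (q' b)) \<and>
        (\<Sum>b\<in>Basis. q' b) \<le> - (q * \<kappa> / bdist x)"
      by (intro exI conjI ballI)
  qed
qed

text \<open>Write bdist x = n i with n = |x| < 1 and i \<le> 2. Taking A at least
  \<open>lambda0 M\<close> gives n^A \<le> n^\<open>lambda0 M\<close>, and A at least A0 gives i^A
  \<le> 2^(A - A0) i^A0; this is the source of the factor 2^(A0 - A).\<close>

lemma W0_lower:
  assumes lower: "\<exists>A>0. \<exists>N>0. \<forall>\<sigma>\<in>M. w \<sigma> \<ge> infdist \<sigma> (closure M - M) powr A / N"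
  obtains A c where "0 < A" "0 < c" "\<And>x. x \<in> cone_of M \<inter> ball 0 1 \<Longrightarrow> c * bdist x powr A \<le> W0 M w x"
proof -
  obtain A0 N where A0: "0 < A0" "0 < N" "\<And>\<sigma>. \<sigma> \<in> M \<Longrightarrow> infdist \<sigma> (closure M - M) powr A0 / N \<le> w \<sigma>"
    using lower by blast
  define A where "A = max A0 (lambda0 M)"
  show ?thesis
  proof (rule that)
    show "0 < A" using A0 by (simp add: A_def)
    show "0 < 2 powr (A0 - A) / N" using A0 by simp
    fix x assume x: "x \<in> cone_of M \<inter> ball 0 1"
    define n where "n = norm x"
    define \<sigma> where "\<sigma> = x /\<^sub>R norm x"
    define i where "i = infdist \<sigma> (closure M - M)"
    have n: "0 < n" "n < 1" and \<sigma>: "\<sigma> \<in> M"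
      using x by (auto simp: cone_of_def n_def \<sigma>_def)
    have i: "0 < i" "i \<le> 2"
      using infdist_boundary[OF \<sigma>] by (metis i_def)+
    have "2 powr (A0 - A) / N * bdist x powr A = 2 powr (A0 - A) / N * (n powr A * i powr A)"
    proof -
      have "bdist x = n * i" by (simp only: bdist_def n_def \<sigma>_def i_def)
      then show ?thesis using n i by (simp add: powr_mult)
    qed
    also have "\<dots> = n powr A * (i powr A0 * (2 powr (A0 - A) * i powr (A - A0)) / N)"
      using i by (simp add: powr_diff)
    also have "\<dots> \<le> n powr lambda0 M * (i powr A0 / N)"
    proof (intro mult_mono)
      show "n powr A \<le> n powr lambda0 M"
        using n by (intro powr_mono') (auto simp: A_def)
      have "i powr (A - A0) \<le> 2 powr (A - A0)"
        using i by (intro powr_mono2) (auto simp: A_def)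
      then have "2 powr (A0 - A) * i powr (A - A0) \<le> 2 powr (A0 - A) * 2 powr (A - A0)"
        by (intro mult_left_mono) auto
      also have "\<dots> = 1" by (simp flip: powr_add)
      finally have "i powr A0 * (2 powr (A0 - A) * i powr (A - A0)) \<le> i powr A0 * 1"
        by (intro mult_left_mono) auto
      then show "i powr A0 * (2 powr (A0 - A) * i powr (A - A0)) / N \<le> i powr A0 / N"
        using A0 by (intro divide_right_mono) auto
    qed (use A0 in auto)
    also have "\<dots> \<le> n powr lambda0 M * w \<sigma>"
      using A0(3)[OF \<sigma>] by (intro mult_left_mono) (auto simp: i_def)
    also have "\<dots> = W0 M w x" by (simp add: W0_def n_def \<sigma>_def)
    finally show "2 powr (A0 - A) / N * bdist x powr A \<le> W0 M w x" .
  qed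
qed

lemma heat_bound_W0:
  assumes w: "first_dirichlet_eigenfunction M w"
    and lower: "\<exists>A>0. \<exists>N>0. \<forall>\<sigma>\<in>M. w \<sigma> \<ge> infdist \<sigma> (closure M - M) powr A / N"
    and eps: "0 < \<epsilon>" "\<epsilon> < 1"
  shows "heat_bound (cone_of M) (W0 M w) (1 - \<epsilon>)"
proof -
  obtain h H \<kappa> where h: "0 < \<kappa>" "continuous_on (cone_of M \<inter> ball 0 1) h"
    "\<And>x. x \<in> cone_of M \<inter> ball 0 1 \<Longrightarrow> 1 \<le> h x \<and> h x \<le> H"
    "\<And>x. x \<in> cone_of M \<inter> ball 0 1 \<Longrightarrow> \<exists>p q.
        (\<forall>b\<in>Basis. derivs2 (\<lambda>s. h (x + s *\<^sub>R b)) (p b) (q b)) \<and> (\<Sum>b\<in>Basis. q b) \<le> - (\<kappa> / bdist x)"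
    by (rule strict_superharmonic) (rule that)
  obtain A c where A: "0 < A" "0 < c"
    "\<And>x. x \<in> cone_of M \<inter> ball 0 1 \<Longrightarrow> c * bdist x powr A \<le> W0 M w x"
    using W0_lower[OF lower] by blast
  have \<Omega>: "open (cone_of M)" using M_open by (rule open_cone_of)
  interpret barrier_domain "cone_of M" "W0 M w" h bdist H \<kappa>
    using \<Omega> W0_pos[OF w] continuous_on_subset[OF W0_continuous[OF w]] W0_harmonic[OF w \<Omega>] h bdist_bounds(1)
    by unfold_locales auto
  \<comment> \<open>With n \<ge> A, steps of size \<gamma> satisfy \<gamma> A \<le> 1, and n of them
    end exactly at 1 - \<epsilon>.\<close>
  define n where "n = nat \<lceil>A\<rceil>"
  define \<gamma> where "\<gamma> = (1 - \<epsilon>) / real n"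
  have n: "0 < n" "A \<le> real n" using A(1) by (auto simp: n_def)
  have \<gamma>: "0 < \<gamma>" "real n * \<gamma> = 1 - \<epsilon>" using n eps by (auto simp: \<gamma>_def)
  have \<gamma>A: "\<gamma> * A \<le> 1"
  proof -
    have "\<gamma> * A \<le> \<gamma> * real n" using n \<gamma> by (intro mult_left_mono) auto
    also have "\<dots> = 1 - \<epsilon>" using \<gamma>(2) by (simp add: mult.commute)
    finally show ?thesis using eps by simp
  qed
  have "heat_bound (cone_of M) (W0 M w) (real n * \<gamma>)"
  \<comment> \<open>The exponent of h takes half of the gap \<epsilon>. The constant comes from
    W^\<gamma> \<ge> c^\<gamma> bdist^(\<gamma> A) and, as bdist < 2 and \<gamma> A \<le> 1, from
    bdist \<le> 2^(1 - \<gamma> A) bdist^(\<gamma> A).\<close>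
  proof (rule heat_bound_iterate[where c = "\<epsilon> / 2" and ?c2.0 = "c powr \<gamma> * 2 powr (\<gamma> * A - 1)"])
    show "real n * \<gamma> + \<epsilon> / 2 < 1" using \<gamma> eps by simp
    fix x assume x: "x \<in> cone_of M \<inter> ball 0 1"
    note b = bdist_bounds[OF x]
    have "bdist x = bdist x powr (\<gamma> * A) * bdist x powr (1 - \<gamma> * A)"
      using b by (simp flip: powr_add)
    also have "\<dots> \<le> bdist x powr (\<gamma> * A) * 2 powr (1 - \<gamma> * A)"
      using b \<gamma>A by (intro mult_left_mono powr_mono2) auto
    finally have "2 powr (\<gamma> * A - 1) * bdist x \<le> 2 powr (\<gamma> * A - 1) * (bdist x powr (\<gamma> * A) * 2 powr (1 - \<gamma> * A))"
      by (intro mult_left_mono) auto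
    also have "\<dots> = bdist x powr (\<gamma> * A)"
      by (simp add: powr_diff)
    finally have "c powr \<gamma> * 2 powr (\<gamma> * A - 1) * bdist x \<le> c powr \<gamma> * bdist x powr (\<gamma> * A)"
      by (simp add: mult.assoc mult_left_mono)
    also have "\<dots> = (c * bdist x powr A) powr \<gamma>"
      using A b by (simp add: powr_mult powr_powr mult.commute)
    also have "\<dots> \<le> W0 M w x powr \<gamma>"
      using A(3)[OF x] A(2) \<gamma> by (intro powr_mono2) auto
    finally show "c powr \<gamma> * 2 powr (\<gamma> * A - 1) * bdist x \<le> W0 M w x powr \<gamma>" .
  qed (use \<gamma> eps A in auto)
  then show ?thesis by (simp add: \<gamma>)
qed

end

text \<open>Otherwise M would be nonempty and both open and closed in the sphere, which is connected
  for d \<ge> 2.\<close>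

lemma boundary_nonempty_if_not_dense:
  fixes M :: "'a::euclidean_space set"
  assumes dim: "DIM('a) \<ge> 2" and M_sub: "M \<subseteq> sphere 0 1"
    and M_open: "openin (top_of_set (sphere 0 1)) M"
    and M_closure: "closure M \<noteq> sphere 0 1" and ne: "M \<noteq> {}"
  shows "closure M - M \<noteq> {}"
proof
  assume "closure M - M = {}"
  then have "closure M = M" using closure_subset[of M] by blast
  then have "closedin (top_of_set (sphere 0 1)) M"
    using M_sub closed_subset closure_eq by metis
  moreover have "connected (sphere (0::'a) 1)"
    using dim by (simp add: connected_sphere)
  ultimately have "M = sphere 0 1"
    using M_open ne connected_clopen by blast
  then show False using \<open>closure M = M\<close> M_closure by simp
qed

text \<open>The supremum is expressed by letting \<open>K\<close> range over all bounds of |u|, so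
  an unbounded \<open>u\<close> is covered vacuously. Smoothness is stated on the open cylinder,
  with continuity up to the top t = 1.\<close>

theorem theorem5p24:
  fixes M :: "'a::euclidean_space set" and w0 :: "'a \<Rightarrow> real"
  assumes dim: "DIM('a) \<ge> 2"
    and M_sub: "M \<subseteq> sphere 0 1"
    and M_conn: "connected M"
    and M_open: "openin (top_of_set (sphere 0 1)) M"
    and M_closure: "closure M \<noteq> sphere 0 1"
    and M_density: "\<exists>c>0. \<forall>p\<in>closure M - M. \<forall>r\<in>{0<..1::real}.
        c \<le> measure sphere_measure {\<sigma>\<in>sphere 0 1 - M. dist \<sigma> p < r} / r ^ (DIM('a) - 1)"
    and w0: "first_dirichlet_eigenfunction M w0"
    and w0_lower: "\<exists>A>0. \<exists>N>0. \<forall>\<sigma>\<in>M. w0 \<sigma> \<ge> infdist \<sigma> (closure M - M) powr A / N"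
    and eps: "0 < \<epsilon>" "\<epsilon> < 1"
    and R: "0 < R" "R < 1"
  shows "\<exists>N>0. \<forall>(u :: real \<times> 'a \<Rightarrow> real) K.
     smooth_on {(t, x). 0 < t \<and> t < 1 \<and> x \<in> cone_of M \<inter> ball 0 1} u \<longrightarrow>
     continuous_on (parab_cyl (cone_of M) 1) u \<longrightarrow>
     (\<forall>t x. 0 < t \<and> t < 1 \<and> x \<in> cone_of M \<inter> ball 0 1 \<longrightarrow>
        time_deriv u (t, x) = space_laplacian u (t, x)) \<longrightarrow>
     (\<forall>t0 x0. 0 < t0 \<and> t0 \<le> 1 \<and> x0 \<in> frontier (cone_of M) \<inter> ball 0 1 \<longrightarrow>
        (u \<longlongrightarrow> 0) (at (t0, x0) within parab_cyl (cone_of M) 1)) \<longrightarrow>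
     (\<forall>p\<in>parab_cyl (cone_of M) 1. \<bar>u p\<bar> \<le> K) \<longrightarrow>
     (\<forall>(t, x)\<in>parab_cyl (cone_of M) R. \<bar>u (t, x)\<bar> \<le> N * K * W0 M w0 x powr (1 - \<epsilon>))"
proof (cases "M = {}")
  case True
  then show ?thesis by (intro exI[of _ 1]) (auto simp: parab_cyl_def cone_of_def)
next
  case False
  interpret conic_domain M
    using assms boundary_nonempty_if_not_dense[OF dim M_sub M_open M_closure False]
    by unfold_locales auto
  let ?\<Omega> = "cone_of M" and ?W = "W0 M w0"
  have "heat_bound ?\<Omega> ?W (1 - \<epsilon>)"
    by (rule heat_bound_W0[OF w0 w0_lower eps])
  then obtain N where N: "0 < N" "\<And>u K t x. 0 < K \<Longrightarrow> heat_sol ?\<Omega> u K \<Longrightarrow> 1 - R\<^sup>2 < t \<Longrightarrow> t < 1 \<Longrightarrow>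
      x \<in> ?\<Omega> \<inter> ball 0 R \<Longrightarrow> u (t, x) \<le> N * K * ?W x powr (1 - \<epsilon>)"
    using R unfolding heat_bound_def by meson
  show ?thesis
  proof (intro exI[of _ N] conjI allI impI N(1) ballI, clarify)
    fix u :: "real \<times> 'a \<Rightarrow> real" and K t x
    assume smooth: "smooth_on {(t, x). 0 < t \<and> t < 1 \<and> x \<in> ?\<Omega> \<inter> ball 0 1} u"
      and cont: "continuous_on (parab_cyl ?\<Omega> 1) u"
      and eq: "\<forall>t x. 0 < t \<and> t < 1 \<and> x \<in> ?\<Omega> \<inter> ball 0 1 \<longrightarrow> time_deriv u (t, x) = space_laplacian u (t, x)"
      and bdry: "\<forall>t0 x0. 0 < t0 \<and> t0 \<le> 1 \<and> x0 \<in> frontier ?\<Omega> \<inter> ball 0 1 \<longrightarrow>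
        (u \<longlongrightarrow> 0) (at (t0, x0) within parab_cyl ?\<Omega> 1)"
      and K: "\<forall>p\<in>parab_cyl ?\<Omega> 1. \<bar>u p\<bar> \<le> K"
      and tx: "(t, x) \<in> parab_cyl ?\<Omega> R"
    have R2: "0 < R\<^sup>2" "R\<^sup>2 < 1" using R by (auto simp: power_less_one_iff)
    have x: "x \<in> ?\<Omega> \<inter> ball 0 R" and t: "1 - R\<^sup>2 < t" "t \<le> 1"
      using tx by (auto simp: parab_cyl_def)
    have x1: "x \<in> ?\<Omega> \<inter> ball 0 1" using x R by auto
    have "\<bar>u (t, x)\<bar> \<le> K" using K t x1 R2 by (auto simp: parab_cyl_def)
    then have K0: "0 \<le> K" by linarith
    have W: "0 < ?W x powr (1 - \<epsilon>)" using W0_pos[OF w0, of x] x by simp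
    have less: "\<bar>u (s, x)\<bar> \<le> N * K * ?W x powr (1 - \<epsilon>)" if s: "1 - R\<^sup>2 < s" "s < 1" for s
    proof (rule field_le_epsilon)
      fix e :: real assume e: "0 < e"
      \<comment> \<open>\<open>heat_bound\<close> asks for a positive bound while \<open>K\<close>
        may be 0; \<open>K'\<close> raises the final estimate by exactly \<open>e\<close>.\<close>
      define K' where "K' = K + e / (N * ?W x powr (1 - \<epsilon>))"
      have K': "0 < K'" "K \<le> K'" using K0 e N(1) W by (auto simp: K'_def add_nonneg_pos)
      have le: "\<bar>u p\<bar> \<le> K'" if "p \<in> parab_cyl ?\<Omega> 1" for p using K that K'(2) by force
      have sol: "heat_sol ?\<Omega> u K'"
        using open_cone_of[OF M_open] smooth cont
      proof (rule heat_solI)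
        show "u p \<le> K'" if "p \<in> parab_cyl ?\<Omega> 1" for p using le[OF that] by simp
      qed (use eq bdry in auto)
      have "u (s, x) \<le> N * K' * ?W x powr (1 - \<epsilon>)"
        by (rule N(2)[OF K'(1) sol s x])
      moreover have "heat_sol ?\<Omega> (\<lambda>p. - u p) K'"
        using sol
      proof (rule heat_sol_uminus)
        show "- K' \<le> u (t, x)" if "t \<in> {0<..<1}" "x \<in> ?\<Omega> \<inter> ball 0 1" for t x
          using le[of "(t, x)"] that by (auto simp: parab_cyl_def)
      qed
      then have "- u (s, x) \<le> N * K' * ?W x powr (1 - \<epsilon>)"
        by (rule N(2)[OF K'(1) _ s x])
      moreover have "N * K' * ?W x powr (1 - \<epsilon>) = N * K * ?W x powr (1 - \<epsilon>) + e"
        using N(1) W by (simp add: K'_def field_simps)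
      ultimately show "\<bar>u (s, x)\<bar> \<le> N * K * ?W x powr (1 - \<epsilon>) + e" by linarith
    qed
    show "\<bar>u (t, x)\<bar> \<le> N * K * ?W x powr (1 - \<epsilon>)"
    proof (cases "t = 1")
      case False
      then show ?thesis using less t by simp
    next
      case True
      \<comment> \<open>\<open>heat_bound\<close> covers t < 1 only, so the top is reached by
        continuity in time. Starting at 1 - R^2 / 2 > 0 keeps the segment inside the unit
        cylinder.\<close>
      let ?a = "1 - R\<^sup>2 / 2"
      have "continuous_on {?a..1} (\<lambda>s. u (s, x))"
        by (rule continuous_on_compose2[OF cont]) (use x1 R2 in \<open>auto simp: parab_cyl_def intro!: continuous_intros\<close>)
      then have "((\<lambda>s. u (s, x)) \<longlongrightarrow> u (1, x)) (at 1 within {?a..1})"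
        using R2 by (simp add: continuous_on_def)
      then have "((\<lambda>s. u (s, x)) \<longlongrightarrow> u (1, x)) (at_left 1)"
        using R2 by (simp add: at_within_Icc_at_left)
      then have "((\<lambda>s. \<bar>u (s, x)\<bar>) \<longlongrightarrow> \<bar>u (1, x)\<bar>) (at_left 1)"
        by (rule tendsto_rabs)
      moreover have "\<forall>\<^sub>F s in at_left 1. \<bar>u (s, x)\<bar> \<le> N * K * ?W x powr (1 - \<epsilon>)"
        using R2 less eventually_at_left[of "1 - R\<^sup>2" 1] by (auto intro!: exI[of _ "1 - R\<^sup>2"])
      ultimately show ?thesis
        using True tendsto_upperbound[of _ _ "at_left (1::real)"] by simp
    qed
  qed
qed

end
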